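(* For any $l\in\mathbb{N}$ there exists a one-to-one (invertible) measure preserving mapping $\tau_l:\mathbb{T}\to\mathbb{T}^\infty$ such that for any $D\subset\mathbb{N}$, if $f\in L^1(\mathbb{T})$ and $g(x)=f(\tau_l^{-1}(x))$, $x\in\mathbb{T}^\infty$, then $$|\{x\in\mathbb{T}:\ \mathcal{R}_D^lf(x)>\lambda\}|=|\{x\in\mathbb{T}^\infty:\ \mathcal{M}_{l/D}\,g(x)>\lambda\}|,\qquad\lambda>0.$$
   Context: $\mathbb{T}=\mathbb{R}/\mathbb{Z}=[0,1)$ with Lebesgue measure; $\mathbb{T}^\infty=\prod_{i=1}^\infty\mathbb{T}$ with the product of the Lebesgue measures; $|\cdot|$ denotes measure on either space. Measure preserving means $|\tau_l(A)|=|A|$ for every Lebesgue measurable $A\subset\mathbb{T}$. Riemann sets: for $n$ dividing $l$, $$I_l(n,t)=\bigcup_{i=0}^{n-1}\left[\frac tl+\frac in,\ \frac{t+1}l+\frac in\right)\subset\mathbb{T},\qquad t=0,1,\ldots,\frac ln-1 .$$ For fixed $l,n$ these sets partition $\mathbb{T}$. For $D\subset\mathbb{N}$ and $f\in L^1(\mathbb{T})$, $$\mathcal{R}_D^lf(x)=\sup_{n\in D:\ n|l,\ x\in I_l(n,t)}\frac1{|I_l(n,t)|}\int_{I_l(n,t)}|f(s)|\,ds .$$ Rectangles: let $p_1<p_2<\ldots$ be all the primes. For a positive integer $m=p_1^{m_1}\cdots p_d^{m_d}$ (some $m_k$ may be zero) and integers $0\le j_k<p_k^{m_k}$, $$B_m(j_1,\ldots,j_d)=\left\{x=(x_1,x_2,\ldots)\in\mathbb{T}^\infty:\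 \frac{j_k}{p_k^{m_k}}\le x_k<\frac{j_k+1}{p_k^{m_k}},\ k=1,\ldots,d\right\}.$$ For $D'\subset\mathbb{N}$ and $g\in L^1(\mathbb{T}^\infty)$, $$\mathcal{M}_{D'}g(x)=\sup_{m\in D':\ x\in B_m(j_1,\ldots,j_d)}\frac1{|B_m(j_1,\ldots,j_d)|}\int_{B_m(j_1,\ldots,j_d)}|g(s)|\,ds .$$ Suprema over the empty set are $0$. Finally, $l/D=\{n\in\mathbb{N}:\ \frac ln\in D\}$. *)

theory Defs
  imports "HOL-Analysis.Analysis" "HOL-Computational_Algebra.Primes"
begin

definition circle :: "real measure" where
  "circle = lebesgue_on {0..<1}"

(* Completed, so that images of arbitrary Lebesgue measurable sets can be measurable.
   Coordinates are counted from 0: the value x k is the coordinate with index k + 1. *)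
definition torus :: "(nat \<Rightarrow> real) measure" where
  "torus = completion (PiM UNIV (\<lambda>_. circle))"

definition measure_preserving :: "'a measure \<Rightarrow> 'b measure \<Rightarrow> ('a \<Rightarrow> 'b) \<Rightarrow> bool" where
  "measure_preserving M N \<tau> \<longleftrightarrow>
     (\<forall>A\<in>sets M. \<tau> ` A \<in> sets N \<and> emeasure N (\<tau> ` A) = emeasure M A)"

definition average :: "'a measure \<Rightarrow> ('a \<Rightarrow> real) \<Rightarrow> 'a set \<Rightarrow> ennreal" where
  "average M f A = (\<integral>\<^sup>+ s\<in>A. ennreal \<bar>f s\<bar> \<partial>M) / emeasure M A"

definition riemann_set :: "nat \<Rightarrow> nat \<Rightarrow> nat \<Rightarrow> real set" where
  "riemann_set l n t =
     (\<Union>i<n. {real t / real l + real i / real n ..< (real t + 1) / real l + real i / real n})"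

(* Both maximal functions take values in ennreal, where the supremum of the empty set is 0. *)
definition riemann_maximal :: "nat \<Rightarrow> nat set \<Rightarrow> (real \<Rightarrow> real) \<Rightarrow> real \<Rightarrow> ennreal" where
  "riemann_maximal l D f x =
     (SUP (n, t) \<in> {(n, t). n \<in> D \<and> n dvd l \<and> t < l div n \<and> x \<in> riemann_set l n t}.
        average circle f (riemann_set l n t))"

definition nth_prime :: "nat \<Rightarrow> nat" where
  "nth_prime k = enumerate {p. prime p} k"

definition side_count :: "nat \<Rightarrow> nat \<Rightarrow> nat" where
  "side_count m k = nth_prime k ^ multiplicity (nth_prime k) m"

(* All coordinates may be constrained at once: if the k-th prime does not divide m, then
   side_count m k = 1, and an admissible j (see rectangle_maximal) has j k = 0, so that the
   condition on x k only says 0 <= x k < 1. *)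
definition rectangle :: "nat \<Rightarrow> (nat \<Rightarrow> nat) \<Rightarrow> (nat \<Rightarrow> real) set" where
  "rectangle m j = {x \<in> space torus.
     \<forall>k. real (j k) / real (side_count m k) \<le> x k \<and>
         x k < (real (j k) + 1) / real (side_count m k)}"

definition rectangle_maximal ::
    "nat set \<Rightarrow> ((nat \<Rightarrow> real) \<Rightarrow> real) \<Rightarrow> (nat \<Rightarrow> real) \<Rightarrow> ennreal" where
  "rectangle_maximal D g x =
     (SUP (m, j) \<in> {(m, j). m \<in> D \<and> (\<forall>k. j k < side_count m k) \<and> x \<in> rectangle m j}.
        average torus g (rectangle m j))"

definition quotient_set :: "nat \<Rightarrow> nat set \<Rightarrow> nat set" where
  "quotient_set l D = {n. n > 0 \<and> n dvd l \<and> l div n \<in> D}"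

end

theory Submission
  imports Defs "HOL-Probability.Infinite_Product_Measure" "HOL-Number_Theory.Cong"
begin

text \<open>Cut the circle into \<open>l\<close> arcs of length \<open>1 / l\<close>, the arc with number \<open>u\<close> starting at \<open>u / l\<close>.
  The set \<open>I_l(n, t)\<close> is the union of the arcs with \<open>u \<equiv> t\<close> modulo \<open>l / n\<close>. On the torus the
  rectangles of order \<open>l\<close> are numbered by residues modulo \<open>l\<close> as well: by the Chinese remainder
  theorem \<open>u\<close> corresponds to its residues modulo the prime powers \<open>p ^ a\<close> in \<open>l\<close>, and writing each
  of these residues in base \<open>p\<close> with the digits reversed turns the residue classes modulo \<open>p ^ b\<close>,
  \<open>b \<le> a\<close>, into intervals of length \<open>p ^ (a - b)\<close>. Thus the rectangles of order \<open>l / n\<close> correspond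
  to the residue classes modulo \<open>l / n\<close>.

  Each rectangle of order \<open>l\<close> is mapped to its arc by interleaving the binary digits of the rescaled
  coordinates. The resulting injection of the torus into the circle is defined everywhere and
  pushes the product measure to Lebesgue measure, since the preimages of arcs of equal length are
  boxes of equal volume. Its inverse becomes a bijection after a change on null sets.\<close>

section \<open>Binary digits\<close>

text \<open>Index \<open>i\<close> carries the weight \<open>1 / 2 ^ Suc i\<close>. Reading digits
  off the floor selects, for dyadic points, the expansion that ends in zeros.\<close>

definition binary_digit :: "nat \<Rightarrow> real \<Rightarrow> int" where
  "binary_digit i x = \<lfloor>2 ^ Suc i * x\<rfloor> mod 2"

definition binary_sum :: "(nat \<Rightarrow> int) \<Rightarrow> real" where
  "binary_sum b = (\<Sum>i. real_of_int (b i) / 2 ^ Suc i)"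

lemma binary_digit_cases: "binary_digit i x \<in> {0, 1}"
  unfolding binary_digit_def by auto

lemma floor_mult_nat:
  assumes "N > 0"
  shows "\<lfloor>real N * w\<rfloor> = int N * \<lfloor>w\<rfloor> + \<lfloor>real N * frac w\<rfloor>"
    and "0 \<le> \<lfloor>real N * frac w\<rfloor>" and "\<lfloor>real N * frac w\<rfloor> < int N"
proof -
  have "real N * w = real_of_int (int N * \<lfloor>w\<rfloor>) + real N * frac w"
    by (simp add: frac_def algebra_simps)
  then show "\<lfloor>real N * w\<rfloor> = int N * \<lfloor>w\<rfloor> + \<lfloor>real N * frac w\<rfloor>"
    by (metis floor_add_int add.commute)
  show "0 \<le> \<lfloor>real N * frac w\<rfloor>" by simp
  show "\<lfloor>real N * frac w\<rfloor> < int N"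
    using assms frac_lt_1[of w] by (simp add: floor_less_iff)
qed

lemma floor_power2_Suc: "\<lfloor>2 ^ Suc n * x\<rfloor> = 2 * \<lfloor>2 ^ n * x\<rfloor> + binary_digit n x"
proof -
  have *: "\<lfloor>2 ^ Suc n * x\<rfloor> = 2 * \<lfloor>2 ^ n * x\<rfloor> + \<lfloor>2 * frac (2 ^ n * x)\<rfloor>"
    using floor_mult_nat(1)[of 2 "2 ^ n * x"] by (simp add: mult.assoc)
  have "0 \<le> \<lfloor>2 * frac (2 ^ n * x)\<rfloor>" "\<lfloor>2 * frac (2 ^ n * x)\<rfloor> < 2"
    using floor_mult_nat(2,3)[of 2 "2 ^ n * x"] by simp_all
  then show ?thesis
    unfolding binary_digit_def * by simp
qed

text \<open>One more digit doubles the floor and adds 0 or 1, so the old floor and the new digit can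
  both be recovered from the new floor. The bounds on \<open>x\<close> and \<open>y\<close> serve
  the base case, where both floors are 0.\<close>

lemma floor_power2_eq_iff:
  assumes "0 \<le> x" "x < 1" "0 \<le> y" "y < 1"
  shows "\<lfloor>2 ^ n * x\<rfloor> = \<lfloor>2 ^ n * y\<rfloor> \<longleftrightarrow> (\<forall>i<n. binary_digit i x = binary_digit i y)"
proof (induction n)
  case 0
  have "\<lfloor>x\<rfloor> = 0" "\<lfloor>y\<rfloor> = 0" using assms by (simp_all add: floor_eq_iff)
  then show ?case by simp
next
  case (Suc n)
  have "binary_digit n x = 0 \<or> binary_digit n x = 1" "binary_digit n y = 0 \<or> binary_digit n y = 1"
    using binary_digit_cases by auto
  then have "\<lfloor>2 ^ Suc n * x\<rfloor> = \<lfloor>2 ^ Suc n * y\<rfloor> \<longleftrightarrow>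
      \<lfloor>2 ^ n * x\<rfloor> = \<lfloor>2 ^ n * y\<rfloor> \<and> binary_digit n x = binary_digit n y"
    unfolding floor_power2_Suc by presburger
  then show ?case
    using Suc by (auto simp: less_Suc_eq)
qed

text \<open>Equal floors at scale \<open>2 ^ n\<close> force
  \<open>\<bar>x - y\<bar> < 1 / 2 ^ n\<close>, for every \<open>n\<close>.\<close>

lemma eq_if_floor_eq:
  assumes "\<And>n. \<lfloor>2 ^ n * x\<rfloor> = \<lfloor>2 ^ n * (y::real)\<rfloor>"
  shows "x = y"
proof (rule ccontr)
  assume "x \<noteq> y"
  then have "\<bar>x - y\<bar> > 0" by simp
  then obtain n where n: "inverse \<bar>x - y\<bar> < 2 ^ n"
    using real_arch_pow[of 2] by auto
  have "\<bar>2 ^ n * x - 2 ^ n * y\<bar> < 1"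
    using assms[of n] by linarith
  then have "2 ^ n * \<bar>x - y\<bar> < 1"
    by (simp add: abs_mult right_diff_distrib[symmetric])
  with n \<open>\<bar>x - y\<bar> > 0\<close> show False
    by (simp add: field_simps)
qed

lemma eq_if_binary_digit_eq:
  assumes "0 \<le> x" "x < 1" "0 \<le> y" "y < 1" "\<And>i. binary_digit i x = binary_digit i y"
  shows "x = y"
  using assms floor_power2_eq_iff[of x y] by (intro eq_if_floor_eq) auto

text \<open>Each digit 1 doubles the gap \<open>1 - frac (2 ^ n * x)\<close>. The gap is positive
  and never exceeds 1, so it cannot double forever.\<close>

lemma binary_digit_not_eventually_one: "\<exists>i\<ge>n. binary_digit i x = 0"
proof (rule ccontr)
  assume "\<not> (\<exists>i\<ge>n. binary_digit i x = 0)"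
  then have one: "binary_digit i x = 1" if "i \<ge> n" for i
    using that binary_digit_cases[of i x] by auto
  have *: "1 - frac (2 ^ (n + m) * x) = 2 ^ m * (1 - frac (2 ^ n * x))" for m
  proof (induction m)
    case (Suc m)
    have "1 - frac (2 ^ Suc (n + m) * x) = 2 * (1 - frac (2 ^ (n + m) * x))"
      unfolding frac_def floor_power2_Suc using one[of "n + m"] by simp
    then show ?case using Suc by simp
  qed simp
  have pos: "1 - frac (2 ^ n * x) > 0" using frac_lt_1[of "2 ^ n * x"] by simp
  then obtain m where "inverse (1 - frac (2 ^ n * x)) < 2 ^ m"
    using real_arch_pow[of 2] by auto
  then have "1 < 2 ^ m * (1 - frac (2 ^ n * x))"
    using pos by (simp add: field_simps)
  also have "\<dots> \<le> 1" unfolding *[symmetric] by simp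
  finally show False by simp
qed

context
  fixes b :: "nat \<Rightarrow> int"
  assumes b01: "\<And>i. b i \<in> {0, 1}" and b0: "\<And>n. \<exists>i\<ge>n. b i = 0"
begin

lemma binary_sum_summable: "summable (\<lambda>i. real_of_int (b (n + i)) / 2 ^ Suc i)"
proof (rule summable_comparison_test')
  show "summable (\<lambda>i. (1 / 2 :: real) ^ Suc i)" by (simp add: summable_geometric)
  show "norm (real_of_int (b (n + i)) / 2 ^ Suc i) \<le> (1 / 2) ^ Suc i" if "i \<ge> 0" for i
    using b01[of "n + i"] by (auto simp: power_divide)
qed

text \<open>The strict upper bound comes from comparison with the series of all ones, whose sum is
  1: a digit 0 beyond position \<open>n\<close> leaves a positive difference. Hence the hypothesis
  that zeros recur.\<close>

lemma binary_sum_shift_bounds: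
  "0 \<le> binary_sum (\<lambda>i. b (n + i))" "binary_sum (\<lambda>i. b (n + i)) < 1"
proof -
  show "0 \<le> binary_sum (\<lambda>i. b (n + i))"
    unfolding binary_sum_def
  proof (rule suminf_nonneg[OF binary_sum_summable])
    show "0 \<le> real_of_int (b (n + i)) / 2 ^ Suc i" for i
      using b01[of "n + i"] by auto
  qed
  obtain i where "i \<ge> n" "b i = 0" using b0 by blast
  then obtain j where j: "b (n + j) = 0" by (metis le_Suc_ex)
  have sum1: "(\<lambda>i. (1 / 2 :: real) ^ Suc i) sums 1"
    by (rule power_half_series)
  have "0 < (\<Sum>i. (1 / 2 :: real) ^ Suc i - real_of_int (b (n + i)) / 2 ^ Suc i)"
  proof (rule suminf_pos2[where i = j])
    show "summable (\<lambda>i. (1 / 2 :: real) ^ Suc i - real_of_int (b (n + i)) / 2 ^ Suc i)"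
      by (intro summable_diff binary_sum_summable sums_summable[OF sum1])
    show "0 \<le> (1 / 2 :: real) ^ Suc i - real_of_int (b (n + i)) / 2 ^ Suc i" for i
      using b01[of "n + i"] by (auto simp: power_divide)
    show "0 < (1 / 2 :: real) ^ Suc j - real_of_int (b (n + j)) / 2 ^ Suc j" using j by simp
  qed
  also have "\<dots> = (\<Sum>i. (1 / 2 :: real) ^ Suc i) - binary_sum (\<lambda>i. b (n + i))"
    unfolding binary_sum_def
    by (intro suminf_diff[symmetric] binary_sum_summable sums_summable[OF sum1])
  finally show "binary_sum (\<lambda>i. b (n + i)) < 1"
    using sums_unique[OF sum1] by simp
qed

lemma binary_sum_bounds: "0 \<le> binary_sum b" "binary_sum b < 1"
  using binary_sum_shift_bounds[of 0] by simp_all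

lemma binary_sum_shift:
  "2 * binary_sum (\<lambda>i. b (n + i)) = real_of_int (b n) + binary_sum (\<lambda>i. b (Suc n + i))"
proof -
  have "(\<Sum>i. real_of_int (b (n + Suc i)) / 2 ^ Suc (Suc i)) =
      binary_sum (\<lambda>i. b (n + i)) - real_of_int (b n) / 2"
    unfolding binary_sum_def
    by (subst suminf_split_head[OF binary_sum_summable[of n]]) simp
  moreover have "binary_sum (\<lambda>i. b (Suc n + i)) / 2 =
      (\<Sum>i. real_of_int (b (n + Suc i)) / 2 ^ Suc (Suc i))"
    unfolding binary_sum_def
    by (subst suminf_divide[OF binary_sum_summable[of "Suc n"], symmetric]) (simp add: mult.commute)
  ultimately show ?thesis by simp
qed

lemma floor_power2_binary_sum:
  "\<exists>q. 2 ^ n * binary_sum b = real_of_int q + binary_sum (\<lambda>i. b (n + i))"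
proof (induction n)
  case 0
  show ?case by (intro exI[of _ 0]) simp
next
  case (Suc n)
  then obtain q where "2 ^ n * binary_sum b = real_of_int q + binary_sum (\<lambda>i. b (n + i))" by blast
  then have "2 ^ Suc n * binary_sum b =
      real_of_int (2 * q + b n) + binary_sum (\<lambda>i. b (Suc n + i))"
    using binary_sum_shift[of n] by simp
  then show ?case by blast
qed

text \<open>After scaling by \<open>2 ^ Suc n\<close> the remaining tail lies in [0,1), so the floor
  is exactly the integer built from the first digits, and its parity is \<open>b n\<close>.\<close>

lemma binary_digit_binary_sum: "binary_digit n (binary_sum b) = b n"
proof -
  obtain q where q: "2 ^ n * binary_sum b = real_of_int q + binary_sum (\<lambda>i. b (n + i))"
    using floor_power2_binary_sum by blast
  have "2 ^ Suc n * binary_sum b = real_of_int (2 * q + b n) + binary_sum (\<lambda>i. b (Suc n + i))"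
    using q binary_sum_shift[of n] by simp
  then have "\<lfloor>2 ^ Suc n * binary_sum b\<rfloor> = 2 * q + b n"
    using binary_sum_shift_bounds[of "Suc n"] by (intro floor_unique) auto
  then show ?thesis
    unfolding binary_digit_def using b01[of n] by auto
qed

end

section \<open>Interleaving digits\<close>

text \<open>Pairing coordinates with digit positions by \<open>prod_encode\<close> lets infinitely
  many coordinates share a single expansion: digit \<open>j\<close> of \<open>y k\<close> goes to
  position \<open>prod_encode (k, j)\<close>.\<close>

definition interleave :: "(nat \<Rightarrow> real) \<Rightarrow> real" where
  "interleave y = binary_sum (\<lambda>i. case prod_decode i of (k, j) \<Rightarrow> binary_digit j (y k))"

text \<open>Thanks to this, the digits of one coordinate keep their order in the interleaved
  expansion, and a prefix of the expansion uses a prefix of each coordinate.\<close>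

lemma prod_encode_mono: "j \<le> j' \<Longrightarrow> prod_encode (k, j) \<le> prod_encode (k, j')"
  unfolding prod_encode_def triangle_def case_prod_conv
  by (intro add_right_mono div_le_mono mult_le_mono) simp_all

lemma le_prod_encode: "k \<le> prod_encode (k, j)" "j \<le> prod_encode (k, j)"
  by (simp_all add: le_prod_encode_1 le_prod_encode_2)

lemma interleaved_digits:
  shows "(case prod_decode i of (k, j) \<Rightarrow> binary_digit j (y k)) \<in> {0, 1}"
    and "\<exists>i\<ge>n. (case prod_decode i of (k, j) \<Rightarrow> binary_digit j (y k)) = 0"
proof -
  show "(case prod_decode i of (k, j) \<Rightarrow> binary_digit j (y k)) \<in> {0, 1}"
    using binary_digit_cases by (auto split: prod.split)
  \<comment> \<open>Coordinate 0 alone already supplies zeros at arbitrarily late positions.\<close>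
  obtain j where j: "j \<ge> n" "binary_digit j (y 0) = 0"
    using binary_digit_not_eventually_one by blast
  then show "\<exists>i\<ge>n. (case prod_decode i of (k, j) \<Rightarrow> binary_digit j (y k)) = 0"
    using le_prod_encode(2)[of j 0] by (intro exI[of _ "prod_encode (0, j)"]) auto
qed

lemma interleave_bounds: "0 \<le> interleave y" "interleave y < 1"
  unfolding interleave_def by (intro binary_sum_bounds interleaved_digits)+

lemma binary_digit_interleave:
  "binary_digit (prod_encode (k, j)) (interleave y) = binary_digit j (y k)"
  unfolding interleave_def by (subst binary_digit_binary_sum[OF interleaved_digits]) simp

lemma interleave_inj:
  assumes "\<And>k. 0 \<le> y k \<and> y k < 1" "\<And>k. 0 \<le> z k \<and> z k < 1" "interleave y = interleave z"
  shows "y = z"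
proof
  fix k
  show "y k = z k"
    using assms binary_digit_interleave[of k _ y] binary_digit_interleave[of k _ z]
    by (intro eq_if_binary_digit_eq) auto
qed

text \<open>The first \<open>n\<close> digits of the interleaved number are the first
  \<open>c k\<close> digits of each coordinate \<open>k\<close>. The counts \<open>c\<close> do not
  depend on \<open>x\<close>, which later makes all boxes of one level equal in volume.\<close>

lemma interleave_prefix:
  obtains c :: "nat \<Rightarrow> nat" where "\<And>k. k \<ge> n \<Longrightarrow> c k = 0"
    "\<And>x::real. 0 \<le> x \<Longrightarrow> x < 1 \<Longrightarrow> \<exists>z. (\<forall>k. 0 \<le> z k \<and> z k < 1) \<and>
      (\<forall>y. (\<forall>k. 0 \<le> y k \<and> y k < 1) \<longrightarrow>
        \<lfloor>2 ^ n * interleave y\<rfloor> = \<lfloor>2 ^ n * x\<rfloor> \<longleftrightarrow> (\<forall>k. \<lfloor>2 ^ c k * y k\<rfloor> = \<lfloor>2 ^ c k * (z k :: real)\<rfloor>))"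
proof
  define c where "c k = (LEAST j. n \<le> prod_encode (k, j))" for k
  have c: "j < c k \<longleftrightarrow> prod_encode (k, j) < n" for j k
  proof -
    have "n \<le> prod_encode (k, n)" by (rule le_prod_encode)
    then have "n \<le> prod_encode (k, c k)" unfolding c_def by (rule LeastI)
    then show ?thesis
      unfolding c_def using not_less_Least prod_encode_mono
      by (metis c_def le_trans linorder_not_le)
  qed
  show "c k = 0" if "k \<ge> n" for k
    using c[of 0 k] le_prod_encode(1)[of k 0] that by simp
  fix x :: real assume x: "0 \<le> x" "x < 1"
  \<comment> \<open>The prefix of \<open>x\<close> prescribes only the first \<open>c k\<close>
    digits of coordinate \<open>k\<close>. Filling up with zeros avoids a tail of ones, so that
    \<open>z k\<close> really has these digits.\<close>
  define e where "e k j = (if j < c k then binary_digit (prod_encode (k, j)) x else 0)" for k j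
  have e01: "e k j \<in> {0, 1}" for k j
    unfolding e_def using binary_digit_cases by auto
  have e0: "\<exists>j\<ge>m. e k j = 0" for k m
    unfolding e_def by (intro exI[of _ "max m (c k)"]) auto
  define z where "z k = binary_sum (e k)" for k
  have z: "0 \<le> z k \<and> z k < 1" "binary_digit j (z k) = e k j" for k j
    unfolding z_def using binary_sum_bounds[OF e01 e0] binary_digit_binary_sum[OF e01 e0] by auto
  show "\<exists>z. (\<forall>k. 0 \<le> z k \<and> z k < 1) \<and>
      (\<forall>y. (\<forall>k. 0 \<le> y k \<and> y k < 1) \<longrightarrow>
        \<lfloor>2 ^ n * interleave y\<rfloor> = \<lfloor>2 ^ n * x\<rfloor> \<longleftrightarrow> (\<forall>k. \<lfloor>2 ^ c k * y k\<rfloor> = \<lfloor>2 ^ c k * (z k :: real)\<rfloor>))"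
  proof (intro exI[of _ z] conjI allI impI)
    fix y :: "nat \<Rightarrow> real" assume y: "\<forall>k. 0 \<le> y k \<and> y k < 1"
    have "\<lfloor>2 ^ n * interleave y\<rfloor> = \<lfloor>2 ^ n * x\<rfloor> \<longleftrightarrow>
        (\<forall>i<n. binary_digit i (interleave y) = binary_digit i x)"
      by (intro floor_power2_eq_iff interleave_bounds x)
    also have "\<dots> \<longleftrightarrow> (\<forall>k. \<forall>j<c k. binary_digit (prod_encode (k, j)) (interleave y) =
        binary_digit (prod_encode (k, j)) x)"
      unfolding c by (metis prod_decode_inverse surj_pair)
    also have "\<dots> \<longleftrightarrow> (\<forall>k. \<forall>j<c k. binary_digit j (y k) = binary_digit j (z k))"
      unfolding binary_digit_interleave by (simp add: z(2) e_def)
    also have "\<dots> \<longleftrightarrow> (\<forall>k. \<lfloor>2 ^ c k * y k\<rfloor> = \<lfloor>2 ^ c k * (z k :: real)\<rfloor>)"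
      using y z(1) by (subst floor_power2_eq_iff) auto
    finally show "\<lfloor>2 ^ n * interleave y\<rfloor> = \<lfloor>2 ^ n * x\<rfloor> \<longleftrightarrow>
        (\<forall>k. \<lfloor>2 ^ c k * y k\<rfloor> = \<lfloor>2 ^ c k * (z k :: real)\<rfloor>)" .
  qed (use z in auto)
qed

section \<open>Digit reversal\<close>

text \<open>The least significant digit of \<open>u\<close> becomes the leading one. Only the lowest
  \<open>a\<close> digits are read, so \<open>u\<close> may be arbitrarily large.\<close>

fun digit_reversal :: "nat \<Rightarrow> nat \<Rightarrow> nat \<Rightarrow> nat" where
  "digit_reversal p 0 u = 0"
| "digit_reversal p (Suc a) u = (u mod p) * p ^ a + digit_reversal p a (u div p)"

lemma digit_reversal_less: "p > 0 \<Longrightarrow> digit_reversal p a u < p ^ a"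
proof (induction a arbitrary: u)
  case (Suc a)
  have "(u mod p) * p ^ a + digit_reversal p a (u div p) < (u mod p) * p ^ a + p ^ a"
    using Suc by simp
  also have "\<dots> = Suc (u mod p) * p ^ a" by simp
  also have "\<dots> \<le> p * p ^ a"
    using Suc by (intro mult_le_mono) (auto simp: Suc_le_eq)
  finally show ?case by simp
qed simp

lemma mult_add_eq_iff:
  fixes N :: nat
  assumes "r < N" "r' < N"
  shows "u * N + r = u' * N + r' \<longleftrightarrow> u = u' \<and> r = r'"
proof
  assume *: "u * N + r = u' * N + r'"
  have "(u * N + r) div N = u" "(u' * N + r') div N = u'" using assms by simp_all
  with * show "u = u' \<and> r = r'" by simp
qed simp

lemma digit_reversal_eq_iff:
  assumes "p > 0"
  shows "digit_reversal p a u = digit_reversal p a v \<longleftrightarrow> u mod p ^ a = v mod p ^ a"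
proof (induction a arbitrary: u v)
  case (Suc a)
  have *: "u mod p ^ Suc a = p * (u div p mod p ^ a) + u mod p" for u
    by (simp add: mod_mult2_eq)
  have "digit_reversal p (Suc a) u = digit_reversal p (Suc a) v \<longleftrightarrow>
      u mod p = v mod p \<and> digit_reversal p a (u div p) = digit_reversal p a (v div p)"
    using mult_add_eq_iff digit_reversal_less[OF assms] by simp
  also have "\<dots> \<longleftrightarrow> u div p mod p ^ a * p + u mod p = v div p mod p ^ a * p + v mod p"
    using assms by (subst mult_add_eq_iff) (auto simp: Suc)
  finally show ?case unfolding * by (simp add: mult.commute)
qed (simp)

text \<open>Division by \<open>p ^ (a - b)\<close> removes the trailing digits, which are the higher
  digits of \<open>u\<close>; what stays is the reversal of its lowest \<open>b\<close> digits. This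
  makes coarser residue classes correspond to longer intervals.\<close>

lemma digit_reversal_div:
  assumes "p > 0" "b \<le> a"
  shows "digit_reversal p a u div p ^ (a - b) = digit_reversal p b u"
  using assms(2)
proof (induction a arbitrary: b u)
  case (Suc a)
  show ?case
  proof (cases b)
    case 0
    then show ?thesis
      using digit_reversal_less[OF assms(1), of "Suc a" u] by (simp del: digit_reversal.simps(2))
  next
    case (Suc b')
    then have "b' \<le> a" using Suc.prems by simp
    then have "p ^ a = p ^ b' * p ^ (a - b')" by (simp add: power_add[symmetric])
    then show ?thesis
      using Suc Suc.IH[OF \<open>b' \<le> a\<close>] assms by (simp add: mult.assoc[symmetric])
  qed
qed simp

text \<open>An injection of the finite set of numbers below \<open>p ^ a\<close> into itself is
  onto.\<close>

lemma digit_reversal_surj: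
  assumes "p > 0" "r < p ^ a"
  shows "\<exists>u. digit_reversal p a u = r"
proof -
  have "inj_on (digit_reversal p a) {..<p ^ a}"
    by (auto simp: inj_on_def digit_reversal_eq_iff[OF assms(1)])
  then have "digit_reversal p a ` {..<p ^ a} = {..<p ^ a}"
    using digit_reversal_less[OF assms(1)] by (intro endo_inj_surj) auto
  then show ?thesis using assms(2) by (metis imageE lessThan_iff)
qed

section \<open>The cells of the finest partition\<close>

lemma nth_prime_prime: "prime (nth_prime k)"
  using enumerate_in_set[OF primes_infinite, of k] unfolding nth_prime_def by simp

lemma nth_prime_pos: "nth_prime k > 0"
  using nth_prime_prime prime_gt_0_nat by blast

lemma nth_prime_eq_iff: "nth_prime i = nth_prime j \<longleftrightarrow> i = j"
  unfolding nth_prime_def by (rule inj_eq[OF inj_enumerate[OF primes_infinite]])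

lemma nth_prime_surj: "prime p \<Longrightarrow> \<exists>k. nth_prime k = p"
  unfolding nth_prime_def using enumerate_Ex[OF primes_infinite] by simp

lemma side_count_pos: "side_count m k > 0"
  unfolding side_count_def using nth_prime_pos by simp

text \<open>A prime dividing \<open>m\<close> is at most \<open>m\<close>, while
  \<open>nth_prime k\<close> is at least \<open>k\<close>. Only finitely many coordinates are
  therefore subdivided.\<close>

lemma multiplicity_nth_prime_eq_0:
  assumes "m > 0" "k > m"
  shows "multiplicity (nth_prime k) m = 0"
proof (rule not_dvd_imp_multiplicity_0)
  have "k \<le> nth_prime k" unfolding nth_prime_def by (rule le_enumerate[OF primes_infinite])
  moreover have "nth_prime k \<le> m" if "nth_prime k dvd m"
    using dvd_imp_le[OF that assms(1)] .
  ultimately show "\<not> nth_prime k dvd m" using assms(2) by linarith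
qed

lemma side_count_dvd: "side_count m k dvd m"
  unfolding side_count_def by (rule multiplicity_dvd)

text \<open>If every full prime power of \<open>m\<close> divides the difference, then so does
  \<open>m\<close>. As natural subtraction truncates, the case \<open>v \<le> u\<close> comes first
  and the other follows by symmetry.\<close>

lemma mod_side_count_eq_iff:
  assumes "m > 0"
  shows "(\<forall>k. u mod side_count m k = v mod side_count m k) \<longleftrightarrow> u mod m = v mod m"
proof
  assume "u mod m = v mod m"
  then show "\<forall>k. u mod side_count m k = v mod side_count m k"
    by (metis mod_mod_cancel side_count_dvd)
next
  have "u mod m = v mod m" if "\<forall>k. u mod side_count m k = v mod side_count m k" "v \<le> u" for u v
  proof (cases "u = v")
    case False
    with that have "u - v \<noteq> 0" by simp
    have "multiplicity p m \<le> multiplicity p (u - v)" if "prime p" for p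
    proof (rule multiplicity_geI)
      obtain k where "p = nth_prime k" using nth_prime_surj[OF \<open>prime p\<close>] by metis
      then have "p ^ multiplicity p m = side_count m k" unfolding side_count_def by simp
      then show "p ^ multiplicity p m dvd u - v"
        using \<open>\<forall>k. u mod _ k = _\<close> mod_eq_dvd_iff_nat[OF \<open>v \<le> u\<close>] by metis
      show "\<not> is_unit p" using \<open>prime p\<close> not_prime_unit by blast
    qed (fact \<open>u - v \<noteq> 0\<close>)
    then have "m dvd u - v" using assms by (intro multiplicity_le_imp_dvd) simp_all
    then show ?thesis using mod_eq_dvd_iff_nat[OF \<open>v \<le> u\<close>] by metis
  qed simp
  then show "u mod m = v mod m" if "\<forall>k. u mod side_count m k = v mod side_count m k"
    using that by (metis nle_le)
qed

text \<open>In coordinate \<open>k\<close> this is the number of the interval, out of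
  \<open>side_count m k\<close> equal ones, that is assigned to the residue
  \<open>u\<close>.\<close>

definition reversed_residue :: "nat \<Rightarrow> nat \<Rightarrow> nat \<Rightarrow> nat" where
  "reversed_residue m u k = digit_reversal (nth_prime k) (multiplicity (nth_prime k) m) u"

lemma reversed_residue_less: "reversed_residue m u k < side_count m k"
  unfolding reversed_residue_def side_count_def by (rule digit_reversal_less[OF nth_prime_pos])

lemma reversed_residue_eq_iff:
  assumes "m > 0"
  shows "reversed_residue m u = reversed_residue m v \<longleftrightarrow> u mod m = v mod m"
proof -
  have "reversed_residue m u = reversed_residue m v \<longleftrightarrow>
      (\<forall>k. u mod side_count m k = v mod side_count m k)"
    unfolding reversed_residue_def side_count_def fun_eq_iff digit_reversal_eq_iff[OF nth_prime_pos] ..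
  then show ?thesis using mod_side_count_eq_iff[OF assms] by simp
qed

text \<open>The number \<open>d\<close> counts the intervals of order \<open>l\<close> that make up
  one interval of order \<open>m\<close> in coordinate \<open>k\<close>; it is a power of the
  \<open>k\<close>-th prime.\<close>

lemma reversed_residue_div:
  assumes "m dvd l" "l > 0"
  obtains d where "d > 0" "side_count l k = side_count m k * d"
    "\<And>u. reversed_residue l u k div d = reversed_residue m u k"
proof
  let ?p = "nth_prime k"
  have le: "multiplicity ?p m \<le> multiplicity ?p l"
    using assms by (intro dvd_imp_multiplicity_le) auto
  show "?p ^ (multiplicity ?p l - multiplicity ?p m) > 0" using nth_prime_pos by simp
  show "side_count l k = side_count m k * ?p ^ (multiplicity ?p l - multiplicity ?p m)"
    unfolding side_count_def using le by (simp add: power_add[symmetric])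
  show "reversed_residue l u k div ?p ^ (multiplicity ?p l - multiplicity ?p m) =
      reversed_residue m u k" for u
    unfolding reversed_residue_def by (rule digit_reversal_div[OF nth_prime_pos le])
qed

lemma reversed_residue_surj:
  assumes "m > 0" "\<And>k. r k < side_count m k"
  shows "\<exists>u<m. reversed_residue m u = r"
proof -
  have "\<exists>v. digit_reversal (nth_prime k) (multiplicity (nth_prime k) m) v = r k" for k
    using digit_reversal_surj[OF nth_prime_pos] assms(2)[of k] unfolding side_count_def by simp
  then obtain v where v: "reversed_residue m (v k) k = r k" for k
    unfolding reversed_residue_def by metis
  have "coprime (side_count m i) (side_count m j)" if "i \<noteq> j" for i j
    unfolding side_count_def using that nth_prime_prime nth_prime_eq_iff
    by (metis coprime_power_left_iff coprime_power_right_iff primes_coprime)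
  \<comment> \<open>The Chinese remainder theorem is applied to the finitely many indices up to
    \<open>m\<close>. For larger \<open>k\<close> the side count is 1, so both labels are 0
    there.\<close>
  then obtain u where u: "[u = v k] (mod side_count m k)" if "k \<le> m" for k
    using chinese_remainder_nat[of "{..m}" "side_count m" v] by auto
  have "reversed_residue m (u mod m) k = r k" for k
  proof (cases "k \<le> m")
    case True
    have "u mod m mod side_count m k = v k mod side_count m k"
      using u[OF True] by (simp add: cong_def mod_mod_cancel side_count_dvd)
    then have "reversed_residue m (u mod m) k = reversed_residue m (v k) k"
      unfolding reversed_residue_def side_count_def digit_reversal_eq_iff[OF nth_prime_pos] .
    then show ?thesis using v by simp
  next
    case False
    then have "side_count m k = 1"
      unfolding side_count_def using multiplicity_nth_prime_eq_0[OF assms(1)] by simp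
    then show ?thesis using assms(2)[of k] reversed_residue_less[of m "u mod m" k] by simp
  qed
  then show ?thesis using assms(1) by (intro exI[of _ "u mod m"]) auto
qed

section \<open>Cells of the torus and arcs of the circle\<close>

lemma space_circle: "space circle = {0..<1}"
  unfolding circle_def by simp

lemma space_torus: "space torus = {x. \<forall>k. 0 \<le> x k \<and> x k < 1}"
  unfolding torus_def by (auto simp: space_PiM space_circle PiE_def Pi_def)

text \<open>The arc number assigned to the rectangle of order \<open>l\<close> around
  \<open>x\<close>. On the torus it exists because every tuple of interval numbers comes from a
  residue, and is unique because \<open>u < l\<close>.\<close>

definition cell :: "nat \<Rightarrow> (nat \<Rightarrow> real) \<Rightarrow> nat" where
  "cell l x = (THE u. u < l \<and> (\<forall>k. int (reversed_residue l u k) = \<lfloor>real (side_count l k) * x k\<rfloor>))"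

lemma cell_props:
  assumes "l > 0" "x \<in> space torus"
  shows "cell l x < l"
    and "int (reversed_residue l (cell l x) k) = \<lfloor>real (side_count l k) * x k\<rfloor>"
    and "u < l \<Longrightarrow> (\<forall>k. \<lfloor>real (side_count l k) * x k\<rfloor> = int (reversed_residue l u k)) \<longleftrightarrow> cell l x = u"
proof -
  have x: "0 \<le> x k" "x k < 1" for k using assms(2) by (auto simp: space_torus)
  have "nat \<lfloor>real (side_count l k) * x k\<rfloor> < side_count l k" for k
    using x[of k] side_count_pos[of l k] by (simp add: nat_less_iff floor_less_iff)
  then obtain u0 where u0: "u0 < l" "reversed_residue l u0 = (\<lambda>k. nat \<lfloor>real (side_count l k) * x k\<rfloor>)"
    using reversed_residue_surj[OF assms(1), of "\<lambda>k. nat \<lfloor>real (side_count l k) * x k\<rfloor>"] by auto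
  have nonneg: "0 \<le> \<lfloor>real (side_count l k) * x k\<rfloor>" for k using x[of k] by simp
  have u0': "(\<forall>k. int (reversed_residue l u k) = \<lfloor>real (side_count l k) * x k\<rfloor>) \<longleftrightarrow> u = u0"
    if "u < l" for u
  proof -
    have "(\<forall>k. int (reversed_residue l u k) = \<lfloor>real (side_count l k) * x k\<rfloor>) \<longleftrightarrow>
        (\<forall>k. reversed_residue l u k = nat \<lfloor>real (side_count l k) * x k\<rfloor>)"
      using nonneg by (metis int_nat_eq nat_int)
    also have "\<dots> \<longleftrightarrow> reversed_residue l u = reversed_residue l u0"
      unfolding u0(2) fun_eq_iff ..
    also have "\<dots> \<longleftrightarrow> u = u0"
      unfolding reversed_residue_eq_iff[OF assms(1)] using that u0(1) by simp
    finally show ?thesis .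
  qed
  have "cell l x = u0"
    unfolding cell_def using u0(1) u0' by (intro the_equality) blast+
  then show "cell l x < l" "int (reversed_residue l (cell l x) k) = \<lfloor>real (side_count l k) * x k\<rfloor>"
    and "u < l \<Longrightarrow> (\<forall>k. \<lfloor>real (side_count l k) * x k\<rfloor> = int (reversed_residue l u k)) \<longleftrightarrow> cell l x = u"
    using u0(1) u0' by (auto simp: eq_commute)
qed

lemma rectangle_iff:
  assumes "x \<in> space torus"
  shows "x \<in> rectangle m j \<longleftrightarrow> (\<forall>k. \<lfloor>real (side_count m k) * x k\<rfloor> = int (j k))"
  unfolding rectangle_def using assms side_count_pos[of m]
  by (simp add: floor_eq_iff field_simps)

text \<open>The coarse floor is the fine floor divided by \<open>d\<close>, and division by
  \<open>d\<close> turns the label of order \<open>l\<close> into that of order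
  \<open>m\<close>.\<close>

lemma floor_side_count:
  assumes "l > 0" "m dvd l" "x \<in> space torus"
  shows "\<lfloor>real (side_count m k) * x k\<rfloor> = int (reversed_residue m (cell l x) k)"
proof -
  obtain d where d: "d > 0" "side_count l k = side_count m k * d"
    "\<And>u. reversed_residue l u k div d = reversed_residue m u k"
    using reversed_residue_div[OF assms(2,1)] by blast
  have "\<lfloor>real (side_count m k) * x k\<rfloor> = \<lfloor>real (side_count l k) * x k / real_of_int (int d)\<rfloor>"
    using d(1,2) by simp
  also have "\<dots> = \<lfloor>real (side_count l k) * x k\<rfloor> div int d"
    by (rule floor_divide_real_eq_div) simp
  also have "\<dots> = int (reversed_residue m (cell l x) k)"
    unfolding cell_props(2)[OF assms(1,3), symmetric] by (simp add: zdiv_int[symmetric] d(3))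
  finally show ?thesis .
qed

lemma rectangle_iff_cell:
  assumes "l > 0" "m dvd l" "x \<in> space torus"
  shows "x \<in> rectangle m j \<longleftrightarrow> j = reversed_residue m (cell l x)"
  unfolding rectangle_iff[OF assms(3)] floor_side_count[OF assms] by (auto simp: fun_eq_iff)

text \<open>With \<open>l = n * m\<close>, the left end \<open>t / l + i / n\<close> equals
  \<open>(t + i * m) / l\<close>. The set thus consists of the arcs with numbers
  \<open>t + i * m\<close>, \<open>i < n\<close>.\<close>

lemma riemann_set_iff:
  assumes "n > 0" "m > 0" "t < m" "0 \<le> x" "x < 1"
  shows "x \<in> riemann_set (n * m) n t \<longleftrightarrow> nat \<lfloor>real (n * m) * x\<rfloor> mod m = t"
proof -
  define u where "u = nat \<lfloor>real (n * m) * x\<rfloor>"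
  have u: "int u = \<lfloor>real (n * m) * x\<rfloor>" unfolding u_def using assms by simp
  have "u < n * m" unfolding u_def using assms by (simp add: nat_less_iff floor_less_iff)
  have "x \<in> riemann_set (n * m) n t \<longleftrightarrow> (\<exists>i<n. \<lfloor>real (n * m) * x\<rfloor> = int (t + i * m))"
    unfolding riemann_set_def floor_eq_iff Bex_def[symmetric] lessThan_iff[symmetric]
    using assms by (simp add: field_simps)
  also have "\<dots> \<longleftrightarrow> (\<exists>i<n. u = t + i * m)"
    unfolding u[symmetric] of_nat_eq_iff ..
  also have "\<dots> \<longleftrightarrow> u mod m = t"
  proof
    assume "u mod m = t"
    then have "u = t + (u div m) * m" using mod_mult_div_eq[of u m] by (simp add: mult.commute)
    moreover have "u div m < n" using \<open>u < n * m\<close> assms(2) by (simp add: less_mult_imp_div_less)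
    ultimately show "\<exists>i<n. u = t + i * m" by blast
  qed (use assms(3) in auto)
  finally show ?thesis unfolding u_def .
qed

section \<open>The injection of the torus into the circle\<close>

definition flatten :: "nat \<Rightarrow> (nat \<Rightarrow> real) \<Rightarrow> real" where
  "flatten l x = (real (cell l x) + interleave (\<lambda>k. frac (real (side_count l k) * x k))) / real l"

lemma floor_mult_flatten:
  assumes "l > 0" "N > 0"
  shows "\<lfloor>real (N * l) * flatten l x\<rfloor> = int N * int (cell l x) +
    \<lfloor>real N * interleave (\<lambda>k. frac (real (side_count l k) * x k))\<rfloor>"
proof -
  have "real (N * l) * flatten l x = real N * interleave (\<lambda>k. frac (real (side_count l k) * x k))
      + real_of_int (int N * int (cell l x))"
    unfolding flatten_def using assms by (simp add: field_simps)
  then show ?thesis by (simp only: floor_add_int[symmetric])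
qed

lemma flatten_bounds:
  assumes "l > 0" "x \<in> space torus"
  shows "flatten l x \<in> space circle"
proof -
  have "real (cell l x) + 1 \<le> real l" using cell_props(1)[OF assms] by linarith
  then have "real (cell l x) + interleave (\<lambda>k. frac (real (side_count l k) * x k)) < real l"
    using interleave_bounds(2)[of "\<lambda>k. frac (real (side_count l k) * x k)"] by linarith
  then show ?thesis
    unfolding flatten_def space_circle using assms interleave_bounds by simp
qed

lemma flatten_cell:
  assumes "l > 0"
  shows "nat \<lfloor>real l * flatten l x\<rfloor> = cell l x"
proof -
  have "\<lfloor>interleave (\<lambda>k. frac (real (side_count l k) * x k))\<rfloor> = 0"
    using interleave_bounds by (simp add: floor_eq_iff)
  then show ?thesis using floor_mult_flatten[OF assms, of 1 x] by simp
qed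

text \<open>The cell recovers the floors of the rescaled coordinates, and interleaving recovers
  their fractional parts.\<close>

lemma flatten_inj:
  assumes "l > 0" shows "inj_on (flatten l) (space torus)"
proof (rule inj_onI)
  fix x y assume x: "x \<in> space torus" and y: "y \<in> space torus" and eq: "flatten l x = flatten l y"
  let ?s = "\<lambda>k. real (side_count l k)"
  have cell: "cell l x = cell l y"
    using flatten_cell[OF assms] eq by metis
  then have "interleave (\<lambda>k. frac (?s k * x k)) = interleave (\<lambda>k. frac (?s k * y k))"
    using eq assms unfolding flatten_def by simp
  then have "(\<lambda>k. frac (?s k * x k)) = (\<lambda>k. frac (?s k * y k))"
    by (intro interleave_inj) (auto simp: frac_lt_1)
  moreover have "\<lfloor>?s k * x k\<rfloor> = \<lfloor>?s k * y k\<rfloor>" for k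
    using cell cell_props(2)[OF assms x] cell_props(2)[OF assms y] by metis
  ultimately have "?s k * x k = ?s k * y k" for k
    unfolding frac_def fun_eq_iff by (metis diff_add_cancel)
  then show "x = y" using side_count_pos[of l] by (simp add: fun_eq_iff) (metis less_irrefl)
qed

text \<open>Both memberships say that \<open>cell l x\<close> is congruent to \<open>t\<close>
  modulo \<open>l div n\<close>.\<close>

lemma flatten_mem_riemann_set:
  assumes "l > 0" "n dvd l" "t < l div n" "x \<in> space torus"
  shows "flatten l x \<in> riemann_set l n t \<longleftrightarrow> x \<in> rectangle (l div n) (reversed_residue (l div n) t)"
proof -
  obtain m where m: "l = n * m" using assms(2) by blast
  with assms have pos: "n > 0" "m > 0" and div: "l div n = m" by auto
  have "flatten l x \<in> riemann_set l n t \<longleftrightarrow> cell l x mod m = t"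
    unfolding flatten_cell[OF assms(1), of x, symmetric] unfolding m
    using flatten_bounds[OF assms(1,4)] assms(3) div m pos
    by (intro riemann_set_iff) (auto simp: space_circle)
  also have "\<dots> \<longleftrightarrow> reversed_residue m t = reversed_residue m (cell l x)"
    unfolding reversed_residue_eq_iff[OF pos(2)] using assms(3) div by auto
  finally show ?thesis
    using rectangle_iff_cell[OF assms(1) _ assms(4)] m unfolding div by simp
qed

text \<open>\<open>N\<close> and \<open>K\<close> are chosen before \<open>a\<close>, so the
  preimages of all arcs of length \<open>1 / (2 ^ n * l)\<close> are boxes with the same side
  lengths; only their position \<open>r\<close> varies.\<close>

lemma flatten_level_sets:
  assumes "l > 0"
  obtains N :: "nat \<Rightarrow> nat" and K where "\<And>k. N k > 0" "\<And>k. k \<ge> K \<Longrightarrow> N k = 1"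
    "\<And>a. 0 \<le> a \<Longrightarrow> a < int (2 ^ n * l) \<Longrightarrow> \<exists>r. (\<forall>k. 0 \<le> r k \<and> r k < int (N k)) \<and>
      {x \<in> space torus. \<lfloor>real (2 ^ n * l) * flatten l x\<rfloor> = a} =
      {x \<in> space torus. \<forall>k. \<lfloor>real (N k) * x k\<rfloor> = r k}"
proof -
  obtain c :: "nat \<Rightarrow> nat" where c0: "\<And>k. k \<ge> n \<Longrightarrow> c k = 0" and
    c: "\<And>x::real. 0 \<le> x \<Longrightarrow> x < 1 \<Longrightarrow> \<exists>z. (\<forall>k. 0 \<le> z k \<and> z k < 1) \<and>
      (\<forall>y. (\<forall>k. 0 \<le> y k \<and> y k < 1) \<longrightarrow>
        \<lfloor>2 ^ n * interleave y\<rfloor> = \<lfloor>2 ^ n * x\<rfloor> \<longleftrightarrow> (\<forall>k. \<lfloor>2 ^ c k * y k\<rfloor> = \<lfloor>2 ^ c k * (z k :: real)\<rfloor>))"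
    using interleave_prefix[of n] by blast
  define N where "N k = 2 ^ c k * side_count l k" for k
  show ?thesis
  proof
    show "N k > 0" for k unfolding N_def using side_count_pos by simp
    \<comment> \<open>From \<open>n\<close> on no binary digit is prescribed, and beyond
      \<open>l\<close> no prime divides \<open>l\<close>.\<close>
    show "N k = 1" if "k \<ge> n + Suc l" for k
      unfolding N_def side_count_def using that c0 multiplicity_nth_prime_eq_0[OF assms] by simp
    fix a :: int assume a: "0 \<le> a" "a < int (2 ^ n * l)"
    \<comment> \<open>The arc number splits as \<open>a = 2 ^ n * u + q\<close>: \<open>u\<close> is
      the cell, and \<open>q\<close> spells the first \<open>n\<close> interleaved digits inside
      it.\<close>
    define u where "u = nat (a div 2 ^ n)"
    define q where "q = a mod 2 ^ n"
    have q: "0 \<le> q" "q < 2 ^ n" unfolding q_def by simp_all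
    have "0 \<le> a div 2 ^ n" using a(1) by (simp add: pos_imp_zdiv_nonneg_iff)
    then have au: "a = 2 ^ n * int u + q" unfolding u_def q_def by simp
    have "2 ^ n * (a div 2 ^ n) \<le> a"
      using mult_div_mod_eq[of "2 ^ n" a] q(1) unfolding q_def by linarith
    also have "a < 2 ^ n * int l" using a(2) by simp
    finally have "2 ^ n * (a div 2 ^ n) < 2 ^ n * int l" .
    then have "a div 2 ^ n < int l" by (simp only: mult_less_cancel_left_pos zero_less_power zero_less_numeral)
    then have u: "u < l" unfolding u_def using a by (simp add: nat_less_iff pos_imp_zdiv_nonneg_iff)
    define w where "w = real_of_int q / 2 ^ n"
    have w: "0 \<le> w" "w < 1" unfolding w_def using q by (simp_all add: field_simps)
    have qw: "q = \<lfloor>2 ^ n * w\<rfloor>" unfolding w_def by simp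
    obtain z where z: "\<forall>k. 0 \<le> z k \<and> z k < 1" and zy:
      "\<And>y. (\<forall>k. 0 \<le> y k \<and> y k < 1) \<Longrightarrow>
        \<lfloor>2 ^ n * interleave y\<rfloor> = q \<longleftrightarrow> (\<forall>k. \<lfloor>2 ^ c k * y k\<rfloor> = \<lfloor>2 ^ c k * (z k :: real)\<rfloor>)"
      using c[OF w] unfolding qw by blast
    \<comment> \<open>Position of the box in coordinate \<open>k\<close>: first the interval of
      order \<open>l\<close>, then one of its \<open>2 ^ c k\<close> dyadic pieces.\<close>
    define r where "r k = 2 ^ c k * int (reversed_residue l u k) + \<lfloor>2 ^ c k * z k\<rfloor>" for k
    have split: "(A::int) * i + s = A * i' + s' \<longleftrightarrow> i = i' \<and> s = s'"
      if "0 \<le> s" "s < A" "0 \<le> s'" "s' < A" for A i i' s s'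
    proof
      assume *: "A * i + s = A * i' + s'"
      have "(A * i + s) div A = i" "(A * i' + s') div A = i'" using that by simp_all
      with * show "i = i' \<and> s = s'" by simp
    qed simp
    have z': "0 \<le> \<lfloor>2 ^ c k * z k\<rfloor>" "\<lfloor>2 ^ c k * z k\<rfloor> < 2 ^ c k" for k
      using z by (simp_all add: floor_less_iff)
    have r: "0 \<le> r k \<and> r k < int (N k)" for k
    proof -
      have "int (reversed_residue l u k) + 1 \<le> int (side_count l k)"
        using reversed_residue_less[of l u k] by simp
      then have "2 ^ c k * (int (reversed_residue l u k) + 1) \<le> 2 ^ c k * int (side_count l k)"
        by (intro mult_left_mono) simp_all
      then show ?thesis
        unfolding r_def N_def using z'[of k] by (simp add: algebra_simps)
    qed
    have "\<lfloor>real (2 ^ n * l) * flatten l x\<rfloor> = a \<longleftrightarrow> (\<forall>k. \<lfloor>real (N k) * x k\<rfloor> = r k)"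
      if x: "x \<in> space torus" for x
    proof -
      let ?v = "\<lambda>k. frac (real (side_count l k) * x k)"
      have "\<lfloor>real (2 ^ n * l) * flatten l x\<rfloor> = a \<longleftrightarrow>
          2 ^ n * int (cell l x) + \<lfloor>2 ^ n * interleave ?v\<rfloor> = 2 ^ n * int u + q"
        using floor_mult_flatten[OF assms, of "2 ^ n" x] au by simp
      also have "\<dots> \<longleftrightarrow> cell l x = u \<and> \<lfloor>2 ^ n * interleave ?v\<rfloor> = q"
        using q interleave_bounds by (subst split) (simp_all add: floor_less_iff)
      also have "\<dots> \<longleftrightarrow> (\<forall>k. \<lfloor>real (side_count l k) * x k\<rfloor> = int (reversed_residue l u k)) \<and>
          (\<forall>k. \<lfloor>2 ^ c k * ?v k\<rfloor> = \<lfloor>2 ^ c k * z k\<rfloor>)"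
        by (subst zy) (simp_all add: cell_props(3)[OF assms x u] frac_lt_1)
      also have "\<dots> \<longleftrightarrow> (\<forall>k. 2 ^ c k * \<lfloor>real (side_count l k) * x k\<rfloor> + \<lfloor>2 ^ c k * ?v k\<rfloor> = r k)"
        unfolding r_def using z' by (subst split) (auto simp: floor_less_iff frac_lt_1)
      also have "\<dots> \<longleftrightarrow> (\<forall>k. \<lfloor>real (N k) * x k\<rfloor> = r k)"
        using floor_mult_nat(1)[of "2 ^ c _" "real (side_count l _) * x _"]
        unfolding N_def by (simp add: mult.assoc)
      finally show ?thesis .
    qed
    then show "\<exists>r. (\<forall>k. 0 \<le> r k \<and> r k < int (N k)) \<and>
      {x \<in> space torus. \<lfloor>real (2 ^ n * l) * flatten l x\<rfloor> = a} =
      {x \<in> space torus. \<forall>k. \<lfloor>real (N k) * x k\<rfloor> = r k}"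
      using r by (intro exI[of _ r]) blast
  qed
qed

section \<open>Measure\<close>

abbreviation cube :: "(nat \<Rightarrow> real) measure" where
  "cube \<equiv> PiM UNIV (\<lambda>_. circle)"

lemma emeasure_circle:
  assumes "A \<in> sets borel" "A \<subseteq> {0..<1}"
  shows "A \<in> sets circle" "emeasure circle A = emeasure lborel A"
  using assms unfolding circle_def
  by (simp_all add: sets_restrict_space_iff emeasure_restrict_space)

lemma prob_space_circle: "prob_space circle"
  by standard (simp add: space_circle emeasure_circle)

lemma circle_id: "(\<lambda>x. x) \<in> circle \<rightarrow>\<^sub>M borel"
  unfolding circle_def by (intro measurable_restrict_space1 measurable_completion) simp

interpretation circle: prob_space circle
  by (rule prob_space_circle)

interpretation cube: product_prob_space "\<lambda>_::nat. circle" UNIV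
  by standard

lemma space_cube: "space cube = space torus"
  unfolding torus_def by simp

lemma floor_level_set_circle:
  assumes "N > 0" "0 \<le> a" "a < int N"
  shows "{x \<in> space circle. \<lfloor>real N * x\<rfloor> = a} \<in> sets circle"
    and "emeasure circle {x \<in> space circle. \<lfloor>real N * x\<rfloor> = a} = ennreal (1 / real N)"
proof -
  have "real_of_int a + 1 \<le> real N" using assms(3) by linarith
  then have in_unit: "0 \<le> x \<and> x < 1"
    if "real_of_int a \<le> real N * x" "real N * x < real_of_int a + 1" for x
  proof -
    have "0 \<le> real N * x" "real N * x < real N * 1" using that assms(2) \<open>_ \<le> real N\<close> by linarith+
    then show ?thesis using assms(1) by (simp add: zero_le_mult_iff)
  qed
  have eq: "{x \<in> space circle. \<lfloor>real N * x\<rfloor> = a} = {real_of_int a / N ..< (real_of_int a + 1) / N}"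
    unfolding space_circle floor_eq_iff using in_unit assms(1) by (auto simp: field_simps)
  have sub: "{real_of_int a / N ..< (real_of_int a + 1) / N} \<subseteq> {0..<1}"
    unfolding eq[symmetric] space_circle[symmetric] by blast
  show "{x \<in> space circle. \<lfloor>real N * x\<rfloor> = a} \<in> sets circle"
    unfolding eq using sub by (intro emeasure_circle) auto
  show "emeasure circle {x \<in> space circle. \<lfloor>real N * x\<rfloor> = a} = ennreal (1 / real N)"
    unfolding eq using sub assms(1)
    by (subst emeasure_circle) (auto simp: divide_right_mono diff_divide_distrib[symmetric])
qed

text \<open>From \<open>K\<close> on the condition reads \<open>\<lfloor>x k\<rfloor> = 0\<close>,
  true on the whole cube. The set is thus a cylinder over the first \<open>K\<close> coordinates,
  and its measure is a finite product.\<close>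

lemma floor_level_set_cube:
  assumes "\<And>k. N k > 0" "\<And>k. k \<ge> K \<Longrightarrow> N k = 1" "\<And>k. 0 \<le> r k \<and> r k < int (N k)"
  shows "{x \<in> space cube. \<forall>k. \<lfloor>real (N k) * x k\<rfloor> = r k} \<in> sets cube"
    and "emeasure cube {x \<in> space cube. \<forall>k. \<lfloor>real (N k) * x k\<rfloor> = r k} =
      (\<Prod>k<K. ennreal (1 / real (N k)))"
proof -
  let ?X = "\<lambda>k. {x \<in> space circle. \<lfloor>real (N k) * x\<rfloor> = r k}"
  have X: "?X k \<in> sets circle" for k using floor_level_set_circle[OF assms(1)] assms(3) by blast
  have "\<lfloor>real (N k) * x k\<rfloor> = r k" if "x \<in> space cube" "k \<ge> K" for x k
  proof -
    have "N k = 1" "r k = 0" using assms(2,3)[of k] that(2) by auto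
    then show ?thesis using that(1) by (simp add: space_cube space_torus floor_eq_iff)
  qed
  then have eq: "{x \<in> space cube. \<forall>k. \<lfloor>real (N k) * x k\<rfloor> = r k} =
      cube.emb UNIV {..<K} (PiE {..<K} ?X)"
    unfolding prod_emb_def by (auto simp: space_PiM PiE_iff) (metis lessThan_iff not_le)
  show "{x \<in> space cube. \<forall>k. \<lfloor>real (N k) * x k\<rfloor> = r k} \<in> sets cube"
    unfolding eq using X by (intro sets_PiM_I) auto
  have "emeasure cube (cube.emb UNIV {..<K} (PiE {..<K} ?X)) = (\<Prod>k<K. emeasure circle (?X k))"
    using X by (intro cube.emeasure_PiM_emb) auto
  also have "\<dots> = (\<Prod>k<K. ennreal (1 / real (N k)))"
    using floor_level_set_circle[OF assms(1)] assms(3) by (intro prod.cong) blast+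
  finally show "emeasure cube {x \<in> space cube. \<forall>k. \<lfloor>real (N k) * x k\<rfloor> = r k} =
      (\<Prod>k<K. ennreal (1 / real (N k)))" unfolding eq .
qed

lemma floor_flatten_level_set:
  assumes "l > 0"
  obtains p where
    "\<And>a. {x \<in> space cube. \<lfloor>real (2 ^ n * l) * flatten l x\<rfloor> = a} \<in> sets cube"
    "\<And>a. 0 \<le> a \<Longrightarrow> a < int (2 ^ n * l) \<Longrightarrow>
      measure cube {x \<in> space cube. \<lfloor>real (2 ^ n * l) * flatten l x\<rfloor> = a} = p"
proof -
  obtain N K where N: "\<And>k. N k > 0" "\<And>k. k \<ge> K \<Longrightarrow> N k = 1"
    and r: "\<And>a. 0 \<le> a \<Longrightarrow> a < int (2 ^ n * l) \<Longrightarrow> \<exists>r. (\<forall>k. 0 \<le> r k \<and> r k < int (N k)) \<and>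
      {x \<in> space torus. \<lfloor>real (2 ^ n * l) * flatten l x\<rfloor> = a} =
      {x \<in> space torus. \<forall>k. \<lfloor>real (N k) * x k\<rfloor> = r k}"
    using flatten_level_sets[OF assms] by blast
  show ?thesis
  proof
    fix a :: int
    show "measure cube {x \<in> space cube. \<lfloor>real (2 ^ n * l) * flatten l x\<rfloor> = a} =
        enn2real (\<Prod>k<K. ennreal (1 / real (N k)))" if a: "0 \<le> a" "a < int (2 ^ n * l)"
    proof -
      obtain r where r': "\<And>k. 0 \<le> r k \<and> r k < int (N k)" and
        eq: "{x \<in> space torus. \<lfloor>real (2 ^ n * l) * flatten l x\<rfloor> = a} =
          {x \<in> space torus. \<forall>k. \<lfloor>real (N k) * x k\<rfloor> = r k}"
        using r[OF a] by blast
      show ?thesis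
        using floor_level_set_cube(2)[of N K r, OF N r'] eq unfolding measure_def space_cube by simp
    qed
    show "{x \<in> space cube. \<lfloor>real (2 ^ n * l) * flatten l x\<rfloor> = a} \<in> sets cube"
    proof (cases "0 \<le> a \<and> a < int (2 ^ n * l)")
      case True
      then obtain r where r': "\<And>k. 0 \<le> r k \<and> r k < int (N k)" and
        eq: "{x \<in> space torus. \<lfloor>real (2 ^ n * l) * flatten l x\<rfloor> = a} =
          {x \<in> space torus. \<forall>k. \<lfloor>real (N k) * x k\<rfloor> = r k}"
        using r[of a] by blast
      then show ?thesis
        using floor_level_set_cube(1)[of N K r, OF N r'] unfolding space_cube by simp
    next
      \<comment> \<open>Since \<open>flatten l\<close> takes values in [0,1), out-of-range values of
        \<open>a\<close> give empty level sets.\<close>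
      case False
      have "0 \<le> \<lfloor>real (2 ^ n * l) * flatten l x\<rfloor>" "\<lfloor>real (2 ^ n * l) * flatten l x\<rfloor> < int (2 ^ n * l)"
        if "x \<in> space torus" for x
        using flatten_bounds[OF assms that] assms by (auto simp: space_circle floor_less_iff)
      with False have "{x \<in> space cube. \<lfloor>real (2 ^ n * l) * flatten l x\<rfloor> = a} = {}"
        unfolding space_cube by auto
      then show ?thesis by (simp only: sets.empty_sets)
    qed
  qed
qed

text \<open>Equally likely arcs of length \<open>1 / N n\<close> determine the distribution function
  up to an error of \<open>1 / N n\<close>, which tends to 0. Measurability follows since
  \<open>G\<close> is the limit of the step functions
  \<open>\<lfloor>N n * G\<rfloor> / N n\<close>.\<close>

lemma (in prob_space) uniform_of_level_sets:
  assumes N: "strict_mono (N :: nat \<Rightarrow> nat)" "\<And>n. N n > 0"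
    and G: "\<And>x. x \<in> space M \<Longrightarrow> 0 \<le> G x \<and> G x < (1::real)"
    and meas: "\<And>n a. {x \<in> space M. \<lfloor>real (N n) * G x\<rfloor> = a} \<in> events"
    and p: "\<And>n a. 0 \<le> a \<Longrightarrow> a < int (N n) \<Longrightarrow> prob {x \<in> space M. \<lfloor>real (N n) * G x\<rfloor> = a} = p n"
  shows "G \<in> borel_measurable M" and "distr M borel G = distr circle borel (\<lambda>x. x)"
proof -
  have lim: "(\<lambda>n. 1 / real (N n)) \<longlonglongrightarrow> 0"
    using LIMSEQ_subseq_LIMSEQ[OF lim_1_over_n N(1)] by (simp add: o_def)
  have floor_meas: "(\<lambda>x. \<lfloor>real (N n) * G x\<rfloor>) \<in> M \<rightarrow>\<^sub>M count_space UNIV" for n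
    using meas[of n] by (subst measurable_count_space_eq2_countable) (auto simp: vimage_def Int_def conj_commute)
  show G_meas: "G \<in> borel_measurable M"
  proof (rule borel_measurable_LIMSEQ_real)
    show "(\<lambda>x. real_of_int \<lfloor>real (N n) * G x\<rfloor> / real (N n)) \<in> borel_measurable M" for n
      using floor_meas by measurable
    show "(\<lambda>n. real_of_int \<lfloor>real (N n) * G x\<rfloor> / real (N n)) \<longlonglongrightarrow> G x" for x
    proof (rule real_tendsto_sandwich)
      show "(\<lambda>n. G x - 1 / real (N n)) \<longlonglongrightarrow> G x"
        using tendsto_diff[OF tendsto_const lim, of "G x"] by simp
      have "G x - 1 / real (N n) \<le> real_of_int \<lfloor>real (N n) * G x\<rfloor> / real (N n)" for n
      proof -
        have "(real (N n) * G x - 1) / real (N n) \<le> real_of_int \<lfloor>real (N n) * G x\<rfloor> / real (N n)"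
          by (intro divide_right_mono) (linarith, simp)
        then show ?thesis using N(2)[of n] by (simp add: diff_divide_distrib)
      qed
      then show "eventually (\<lambda>n. G x - 1 / real (N n) \<le> real_of_int \<lfloor>real (N n) * G x\<rfloor> / real (N n)) sequentially"
        by simp
      show "eventually (\<lambda>n. real_of_int \<lfloor>real (N n) * G x\<rfloor> / real (N n) \<le> G x) sequentially"
        using N(2) by (intro always_eventually) (simp add: divide_le_eq mult.commute)
    qed simp
  qed
  have less: "prob {x \<in> space M. \<lfloor>real (N n) * G x\<rfloor> < a} = real_of_int a * p n"
    if "0 \<le> a" "a \<le> int (N n)" for n a
  proof -
    have "{x \<in> space M. \<lfloor>real (N n) * G x\<rfloor> < a} =
        (\<Union>b\<in>{0..<a}. {x \<in> space M. \<lfloor>real (N n) * G x\<rfloor> = b})"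
      using G by (auto simp: zero_le_floor)
    moreover have "prob (\<Union>b\<in>{0..<a}. {x \<in> space M. \<lfloor>real (N n) * G x\<rfloor> = b}) =
        (\<Sum>b\<in>{0..<a}. prob {x \<in> space M. \<lfloor>real (N n) * G x\<rfloor> = b})"
      using meas by (intro finite_measure_finite_Union) (auto simp: disjoint_family_on_def)
    moreover have "\<dots> = (\<Sum>b\<in>{0..<a}. p n)"
      using p that by (intro sum.cong) auto
    ultimately show ?thesis using that by simp
  qed
  \<comment> \<open>The \<open>N n\<close> level sets have equal probability and exhaust the
    space.\<close>
  have p_eq: "p n = 1 / real (N n)" for n
  proof -
    have "{x \<in> space M. \<lfloor>real (N n) * G x\<rfloor> < int (N n)} = space M"
      using G N(2)[of n] by (auto simp: floor_less_iff)
    then show ?thesis using less[of "int (N n)" n] N(2)[of n] by (simp add: prob_space field_simps)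
  qed
  have cdf: "prob {x \<in> space M. G x \<le> t} = t" if "0 \<le> t" "t < 1" for t
  proof (rule LIMSEQ_unique)
    show "(\<lambda>n. prob {x \<in> space M. G x \<le> t}) \<longlonglongrightarrow> prob {x \<in> space M. G x \<le> t}" by simp
    show "(\<lambda>n. prob {x \<in> space M. G x \<le> t}) \<longlonglongrightarrow> t"
    proof (rule real_tendsto_sandwich)
      show "(\<lambda>n. t - 1 / real (N n)) \<longlonglongrightarrow> t" "(\<lambda>n. t + 1 / real (N n)) \<longlonglongrightarrow> t"
        using tendsto_diff[OF tendsto_const lim, of t] tendsto_add[OF tendsto_const lim, of t] by simp_all
      have "t - 1 / real (N n) \<le> prob {x \<in> space M. G x \<le> t} \<and>
          prob {x \<in> space M. G x \<le> t} \<le> t + 1 / real (N n)" for n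
      proof -
        \<comment> \<open>The set \<open>G x \<le> t\<close> lies between the union of the first
          \<open>a\<close> level sets and that of the first \<open>a + 1\<close>.\<close>
        define a where "a = \<lfloor>real (N n) * t\<rfloor>"
        have Nn: "real (N n) > 0" using N(2) by simp
        have a: "0 \<le> a" "a < int (N n)"
          unfolding a_def using that Nn by (simp_all add: floor_less_iff)
        have bounds: "real_of_int a \<le> real (N n) * t" "real (N n) * t < real_of_int a + 1"
          unfolding a_def by linarith+
        have "G x \<le> t" if "\<lfloor>real (N n) * G x\<rfloor> < a" for x
        proof -
          have "real (N n) * G x < real (N n) * t" using that bounds by linarith
          then show ?thesis using Nn by simp
        qed
        then have "prob {x \<in> space M. \<lfloor>real (N n) * G x\<rfloor> < a} \<le> prob {x \<in> space M. G x \<le> t}"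
          using G_meas by (intro finite_measure_mono) auto
        moreover have "\<lfloor>real (N n) * G x\<rfloor> < a + 1" if "G x \<le> t" for x
        proof -
          have "real (N n) * G x \<le> real (N n) * t" using that Nn by simp
          then show ?thesis using bounds by linarith
        qed
        then have "prob {x \<in> space M. G x \<le> t} \<le> prob {x \<in> space M. \<lfloor>real (N n) * G x\<rfloor> < a + 1}"
          using floor_meas by (intro finite_measure_mono) auto
        moreover have "(real (N n) * t - 1) / real (N n) \<le> real_of_int a / real (N n)"
          "(real_of_int a + 1) / real (N n) \<le> (real (N n) * t + 1) / real (N n)"
          using bounds by (intro divide_right_mono; simp)+
        then have "t - 1 / real (N n) \<le> real_of_int a / real (N n)"
          "(real_of_int a + 1) / real (N n) \<le> t + 1 / real (N n)"
          using Nn by (simp_all add: diff_divide_distrib add_divide_distrib)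
        ultimately show ?thesis
          using less[of a n] less[of "a + 1" n] a unfolding p_eq by auto
      qed
      then show "eventually (\<lambda>n. t - 1 / real (N n) \<le> prob {x \<in> space M. G x \<le> t}) sequentially"
        "eventually (\<lambda>n. prob {x \<in> space M. G x \<le> t} \<le> t + 1 / real (N n)) sequentially"
        by simp_all
    qed
  qed
  show "distr M borel G = distr circle borel (\<lambda>x. x)"
  proof (rule measure_eqI_lessThan)
    fix t :: real
    have *: "emeasure (distr M borel G) {t<..} = emeasure M {x \<in> space M. t < G x}"
      using G_meas by (subst emeasure_distr) (auto simp: vimage_def Int_def conj_commute)
    show "emeasure (distr M borel G) {t<..} < \<infinity>"
      unfolding * by (simp add: less_top[symmetric])
    have **: "emeasure (distr circle borel (\<lambda>x. x)) {t<..} = emeasure lborel ({t<..} \<inter> {0..<1})"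
      using circle_id
      by (subst emeasure_distr) (auto simp: space_circle intro!: emeasure_circle)
    consider "t < 0" | "1 \<le> t" | "0 \<le> t" "t < 1" by linarith
    then show "emeasure (distr M borel G) {t<..} = emeasure (distr circle borel (\<lambda>x. x)) {t<..}"
    proof cases
      case 1
      have "{x \<in> space M. t < G x} = space M" using G 1 by force
      moreover have "{t<..} \<inter> {0..<1} = {0..<1}" using 1 by auto
      ultimately show ?thesis unfolding * ** by (simp add: emeasure_space_1)
    next
      case 2
      have "{x \<in> space M. t < G x} = {}" using G 2 by force
      moreover have "{t<..} \<inter> {0..<1} = {}" using 2 by auto
      ultimately show ?thesis unfolding * ** by (simp only: emeasure_empty)
    next
      case 3
      have "{x \<in> space M. t < G x} = space M - {x \<in> space M. G x \<le> t}" by auto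
      then have "prob {x \<in> space M. t < G x} = 1 - t"
        using G_meas by (subst cdf[OF 3, symmetric]) (simp add: prob_compl)
      moreover have "{t<..} \<inter> {0..<1} = {t<..<1}" using 3 by auto
      ultimately show ?thesis unfolding * ** using 3 by (simp add: emeasure_eq_measure)
    qed
  qed simp_all
qed

lemma flatten_distr:
  assumes "l > 0"
  shows "flatten l \<in> borel_measurable cube" "distr cube borel (flatten l) = distr circle borel (\<lambda>x. x)"
proof -
  let ?L = "\<lambda>n a. {x \<in> space cube. \<lfloor>real (2 ^ n * l) * flatten l x\<rfloor> = a}"
  have "\<forall>n. \<exists>p. (\<forall>a. ?L n a \<in> sets cube) \<and>
      (\<forall>a. 0 \<le> a \<longrightarrow> a < int (2 ^ n * l) \<longrightarrow> measure cube (?L n a) = p)"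
    by (rule allI, rule floor_flatten_level_set[OF assms]) blast
  from choice[OF this] obtain p where "\<forall>n. (\<forall>a. ?L n a \<in> sets cube) \<and>
      (\<forall>a. 0 \<le> a \<longrightarrow> a < int (2 ^ n * l) \<longrightarrow> measure cube (?L n a) = p n)" ..
  then have p: "\<And>n a. ?L n a \<in> sets cube"
      "\<And>n a. 0 \<le> a \<Longrightarrow> a < int (2 ^ n * l) \<Longrightarrow> measure cube (?L n a) = p n"
    by blast+
  have N: "strict_mono (\<lambda>n. 2 ^ n * l)" "\<And>n. 2 ^ n * l > 0"
    using assms by (auto simp: strict_mono_def)
  have G: "\<And>x. x \<in> space cube \<Longrightarrow> 0 \<le> flatten l x \<and> flatten l x < 1"
    using flatten_bounds[OF assms] by (simp add: space_cube space_circle)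
  show "flatten l \<in> borel_measurable cube" "distr cube borel (flatten l) = distr circle borel (\<lambda>x. x)"
    by (rule cube.uniform_of_level_sets[OF N G p]; assumption)+
qed

text \<open>This passes from Borel sets to the completions. A Lebesgue set is a Borel set together
  with part of a Borel null set, and the preimage of that part lies in a null set of the
  cube.\<close>

lemma flatten_measure_preserving:
  assumes "l > 0"
  shows "flatten l \<in> torus \<rightarrow>\<^sub>M circle" "distr torus circle (flatten l) = circle"
proof -
  let ?G = "flatten l"
  note meas = flatten_distr(1)[OF assms]
  have borel: "?G -` A \<inter> space cube \<in> sets cube"
    "emeasure cube (?G -` A \<inter> space cube) = emeasure lborel A" if "A \<in> sets borel" "A \<subseteq> {0..<1}" for A
  proof -
    show "?G -` A \<inter> space cube \<in> sets cube" using measurable_sets[OF meas that(1)] .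
    have "emeasure cube (?G -` A \<inter> space cube) = emeasure (distr cube borel ?G) A"
      using meas that by (simp add: emeasure_distr)
    also have "\<dots> = emeasure circle A"
      unfolding flatten_distr(2)[OF assms] using that
      by (subst emeasure_distr[OF circle_id]) (simp_all add: space_circle Int_absorb2)
    finally show "emeasure cube (?G -` A \<inter> space cube) = emeasure lborel A"
      using emeasure_circle that by simp
  qed
  have main: "?G -` A \<inter> space torus \<in> sets torus \<and>
      emeasure torus (?G -` A \<inter> space torus) = emeasure circle A" if "A \<in> sets circle" for A
  proof -
    have A: "A \<subseteq> {0..<1}" "A \<in> sets lebesgue"
      using that by (auto simp: circle_def sets_restrict_space_iff)
    then obtain S N N' where SN: "A = S \<union> N" "N \<subseteq> N'" "N' \<in> null_sets lborel" "S \<in> sets lborel"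
      by (auto elim: sets_completionE)
    \<comment> \<open>The Borel case is available only inside [0,1); cutting \<open>N'\<close> down
      does not change its preimage.\<close>
    have "N' \<inter> {0..<1} \<in> null_sets lborel"
      using SN(3) by (rule null_set_Int2) simp
    then have "?G -` (N' \<inter> {0..<1}) \<inter> space cube \<in> null_sets cube"
      using borel[of "N' \<inter> {0..<1}"] by (simp add: null_sets_def del: vimage_Int)
    also have "?G -` (N' \<inter> {0..<1}) \<inter> space cube = ?G -` N' \<inter> space cube"
      using flatten_bounds[OF assms] by (auto simp: space_cube space_circle)
    finally have "?G -` N' \<inter> space cube \<in> null_sets cube" .
    then have null: "?G -` N \<inter> space torus \<in> null_sets torus"
      unfolding torus_def null_sets_completion_iff2 space_completion using SN(2)
      by (intro bexI[of _ "?G -` N' \<inter> space cube"]) auto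
    have S: "?G -` S \<inter> space cube \<in> sets cube" "emeasure cube (?G -` S \<inter> space cube) = emeasure lborel S"
      using borel[of S] SN(1,4) A(1) by simp_all
    have "?G -` A \<inter> space torus = (?G -` S \<inter> space torus) \<union> (?G -` N \<inter> space torus)"
      unfolding SN(1) by auto
    moreover have "?G -` S \<inter> space torus \<in> sets torus"
      using S(1) unfolding torus_def by simp
    moreover have "emeasure torus (?G -` S \<inter> space torus) = emeasure lborel S"
      using S unfolding torus_def by simp
    moreover have "emeasure circle A = emeasure lborel S"
    proof -
      have "N \<in> null_sets lebesgue"
        using SN(2,3) unfolding null_sets_completion_iff2 by blast
      then have "emeasure lebesgue A = emeasure lebesgue S"
        unfolding SN(1) using SN(4) by (intro emeasure_Un_null_set) auto
      then show ?thesis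
        unfolding circle_def using A SN(4) by (simp add: emeasure_restrict_space)
    qed
    ultimately show ?thesis
      using null sets.Un[OF _ null_setsD2[OF null]] by (simp add: emeasure_Un_null_set)
  qed
  show meas': "flatten l \<in> torus \<rightarrow>\<^sub>M circle"
    using main flatten_bounds[OF assms] by (intro measurableI) blast+
  show "distr torus circle (flatten l) = circle"
    using main by (intro measure_eqI) (auto simp: emeasure_distr meas')
qed

section \<open>The bijection\<close>

lemma null_torus: "{x \<in> space torus. x 1 = 0} \<in> null_sets torus"
proof -
  have zero: "{0} \<in> sets circle" "emeasure circle {0} = 0"
    by (simp_all add: emeasure_circle)
  have eq: "{x \<in> space torus. x 1 = 0} = cube.emb UNIV {1} (PiE {1} (\<lambda>_. {0}))"
    unfolding prod_emb_def
    by (auto simp: space_cube[symmetric] space_PiM PiE_iff fun_eq_iff restrict_def split: if_splits)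
  have "cube.emb UNIV {1} (PiE {1} (\<lambda>_. {0})) \<in> sets cube"
    using zero by (intro sets_PiM_I) auto
  moreover have "emeasure cube (cube.emb UNIV {1} (PiE {1} (\<lambda>_. {0}))) = 0"
    using zero by (subst cube.emeasure_PiM_emb) auto
  ultimately show ?thesis
    unfolding eq unfolding torus_def by (intro null_sets_completionI null_setsI)
qed

text \<open>The complement of the image of the injection has to be matched with a null set; the null
  set of points with second coordinate 0 is chosen because it contains a copy of the circle.\<close>

lemma bijection_extending_inverse:
  assumes G: "inj_on G (space torus)" "G ` space torus \<subseteq> space circle"
  obtains \<tau> where "bij_betw \<tau> (space circle) (space torus)"
    "\<And>x. x \<in> space torus \<Longrightarrow> x 1 \<noteq> 0 \<Longrightarrow> \<tau> (G x) = x"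
proof -
  define Z where "Z = {x \<in> space torus. x 1 = 0}"
  define W where "W = space circle - G ` (space torus - Z)"
  \<comment> \<open>One injection puts a circle point into coordinate 0 and zeros elsewhere, which
    lands in \<open>Z\<close>. The other is \<open>G\<close>: by injectivity it sends
    \<open>Z\<close> outside the image of the complement of \<open>Z\<close>.\<close>
  have "\<exists>b. bij_betw b W Z"
  proof (rule Schroeder_Bernstein)
    show "inj_on (\<lambda>x k. if k = (0::nat) then x else (0::real)) W"
      by (auto simp: inj_on_def fun_eq_iff split: if_splits)
    show "(\<lambda>x k. if k = (0::nat) then x else (0::real)) ` W \<subseteq> Z"
      unfolding W_def Z_def by (auto simp: space_circle space_torus)
    show "inj_on G Z" using G(1) unfolding Z_def by (rule inj_on_subset) blast
    show "G ` Z \<subseteq> W"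
      using G unfolding W_def Z_def inj_on_def by blast
  qed
  then obtain b where b: "bij_betw b W Z" ..
  \<comment> \<open>Outside \<open>W\<close> the map inverts \<open>G\<close>; on \<open>W\<close>,
    the part not covered by the image of the complement of \<open>Z\<close>, it is the matching
    \<open>b\<close>.\<close>
  define \<tau> where "\<tau> x = (if x \<in> W then b x else inv_into (space torus) G x)" for x
  have \<tau>: "\<tau> (G x) = x" if "x \<in> space torus - Z" for x
    unfolding \<tau>_def W_def using that G(1) by simp
  show ?thesis
  proof
    have "bij_betw \<tau> (G ` (space torus - Z)) (space torus - Z)"
      using \<tau> by (intro bij_betw_byWitness[where f' = G]) auto
    moreover have "bij_betw \<tau> W Z"
      using b by (rule bij_betw_cong[THEN iffD1, rotated]) (simp add: \<tau>_def)
    ultimately have "bij_betw \<tau> (W \<union> G ` (space torus - Z)) (Z \<union> (space torus - Z))"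
      by (intro bij_betw_combine) auto
    moreover have "W \<union> G ` (space torus - Z) = space circle" "Z \<union> (space torus - Z) = space torus"
      using G(2) unfolding W_def Z_def by auto
    ultimately show "bij_betw \<tau> (space circle) (space torus)" by simp
    show "\<tau> (G x) = x" if "x \<in> space torus" "x 1 \<noteq> 0" for x
      using \<tau> that unfolding Z_def by simp
  qed
qed

text \<open>Off \<open>Z\<close> the image of \<open>A\<close> under \<open>\<tau>\<close> coincides
  with the preimage of \<open>A\<close> under \<open>G\<close>. The remainder is a subset of a null
  set, hence measurable by completeness.\<close>

lemma (in complete_measure) measure_preserving_of_ae_inverse:
  assumes G: "G \<in> M \<rightarrow>\<^sub>M N" "distr M N G = N" and \<tau>: "bij_betw \<tau> (space N) (space M)"
    and Z: "Z \<in> null_sets M" "\<And>x. x \<in> space M - Z \<Longrightarrow> \<tau> (G x) = x"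
  shows "measure_preserving N M \<tau>"
  unfolding measure_preserving_def
proof (intro ballI)
  fix A assume A: "A \<in> sets N"
  let ?B = "G -` A \<inter> space M"
  have B: "?B \<in> sets M" "emeasure M ?B = emeasure N A"
    using measurable_sets[OF G(1) A] emeasure_distr[OF G(1) A] G(2) by simp_all
  \<comment> \<open>If \<open>x\<close> is the image of some \<open>a\<close> in \<open>A\<close>,
    then \<open>\<tau> (G x) = x\<close> and injectivity of \<open>\<tau>\<close> give
    \<open>a = G x\<close>.\<close>
  have "x \<in> \<tau> ` A \<longleftrightarrow> G x \<in> A" if x: "x \<in> space M - Z" for x
  proof -
    have "G x \<in> space N" using x measurable_space[OF G(1)] by blast
    then show ?thesis
      using Z(2)[OF x] \<tau> sets.sets_into_space[OF A] unfolding bij_betw_def inj_on_def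
      by (metis image_iff subsetD)
  qed
  moreover have "\<tau> ` A \<subseteq> space M"
    using \<tau> sets.sets_into_space[OF A] unfolding bij_betw_def by blast
  ultimately have "\<tau> ` A = (?B - Z) \<union> (\<tau> ` A \<inter> Z)" by blast
  moreover have "\<tau> ` A \<inter> Z \<in> null_sets M"
    using complete2[OF _ Z(1), of "\<tau> ` A \<inter> Z"] by blast
  ultimately obtain Q where eq: "\<tau> ` A = (?B - Z) \<union> Q" and null: "Q \<in> null_sets M" by blast
  have "?B - Z \<in> sets M" "emeasure M (?B - Z) = emeasure M ?B"
    using B(1) Z(1) by (auto intro: emeasure_Diff_null_set)
  then show "\<tau> ` A \<in> sets M \<and> emeasure M (\<tau> ` A) = emeasure N A"
    using null B(2) sets.Un[OF _ null_setsD2[OF null]] unfolding eq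
    by (simp add: emeasure_Un_null_set)
qed

section \<open>Maximal functions\<close>

lemma riemann_set_sets:
  assumes "l > 0" "n dvd l" "t < l div n"
  shows "riemann_set l n t \<in> sets circle"
proof (rule emeasure_circle)
  show "riemann_set l n t \<in> sets borel" unfolding riemann_set_def by measurable
  obtain m where m: "l = n * m" using assms(2) by blast
  with assms have pos: "n > 0" "m > 0" "t < m" by auto
  have "(real t + 1) / real l + real i / real n \<le> 1" if "i < n" for i
  proof -
    have "t + 1 + i * m \<le> (i + 1) * m" using pos(3) by simp
    also have "\<dots> \<le> n * m" using that by (intro mult_le_mono1) simp
    finally have "real (t + 1 + i * m) \<le> real (n * m)" by (rule of_nat_mono)
    then show ?thesis unfolding m using pos by (simp add: field_simps)
  qed
  moreover have "0 \<le> real t / real l + real i / real n" for i by simp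
  ultimately have part: "{real t / real l + real i / real n ..< (real t + 1) / real l + real i / real n} \<subseteq> {0..<1}"
    if "i < n" for i
    using that by (intro ivl_subset[THEN iffD2] disjI2 conjI) blast+
  show "riemann_set l n t \<subseteq> {0..<1}"
    unfolding riemann_set_def by (rule UN_least, rule part) simp
qed

text \<open>A change of variables along \<open>G\<close>. The integrand may use \<open>h\<close>
  because null sets do not affect integrals, while the domain of integration is the exact preimage
  under \<open>G\<close>.\<close>

lemma average_eq:
  assumes G: "G \<in> M \<rightarrow>\<^sub>M N" "distr M N G = N" and f: "f \<in> borel_measurable N"
    and h: "AE x in M. h x = G x" and A: "A \<in> sets N"
  shows "average N f A = average M (\<lambda>x. f (h x)) (G -` A \<inter> space M)"
proof -
  have meas: "(\<lambda>s. ennreal \<bar>f s\<bar> * indicator A s) \<in> borel_measurable N"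
    using f A by measurable
  have "(\<integral>\<^sup>+ s. ennreal \<bar>f s\<bar> * indicator A s \<partial>N) =
      (\<integral>\<^sup>+ s. ennreal \<bar>f s\<bar> * indicator A s \<partial>distr M N G)"
    unfolding G(2) ..
  also have "\<dots> = (\<integral>\<^sup>+ x. ennreal \<bar>f (G x)\<bar> * indicator A (G x) \<partial>M)"
    using meas by (subst nn_integral_distr[OF G(1)]) simp_all
  also have "\<dots> = (\<integral>\<^sup>+ x. ennreal \<bar>f (h x)\<bar> * indicator (G -` A \<inter> space M) x \<partial>M)"
    using h AE_space by (intro nn_integral_cong_AE) (auto elim!: eventually_elim2 split: split_indicator)
  finally have "(\<integral>\<^sup>+ s. ennreal \<bar>f s\<bar> * indicator A s \<partial>N) =
      (\<integral>\<^sup>+ x. ennreal \<bar>f (h x)\<bar> * indicator (G -` A \<inter> space M) x \<partial>M)" .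
  moreover have "emeasure N A = emeasure M (G -` A \<inter> space M)"
    using emeasure_distr[OF G(1) A] G(2) by simp
  ultimately show ?thesis unfolding average_def by simp
qed

text \<open>The supremum exceeds \<open>c\<close> exactly when one of the averages does, so the set
  is a countable union of Riemann sets.\<close>

lemma riemann_maximal_superlevel_sets:
  assumes "l > 0"
  shows "{x \<in> space circle. riemann_maximal l D f x > c} \<in> sets circle"
proof -
  let ?P = "{(n, t). n \<in> D \<and> n dvd l \<and> t < l div n \<and> average circle f (riemann_set l n t) > c}"
  have "{x \<in> space circle. riemann_maximal l D f x > c} = (\<Union>(n, t)\<in>?P. riemann_set l n t)"
  proof (rule set_eqI)
    fix x
    have "riemann_maximal l D f x > c \<longleftrightarrow>
        (\<exists>n t. n \<in> D \<and> n dvd l \<and> t < l div n \<and> average circle f (riemann_set l n t) > c \<and> x \<in> riemann_set l n t)"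
      unfolding riemann_maximal_def less_SUP_iff Bex_def split_paired_Ex mem_Collect_eq case_prod_conv
      by blast
    moreover have "x \<in> space circle" if "n dvd l" "t < l div n" "x \<in> riemann_set l n t" for n t
      using sets.sets_into_space[OF riemann_set_sets[OF assms that(1,2)]] that(3) by blast
    ultimately show "x \<in> {x \<in> space circle. riemann_maximal l D f x > c} \<longleftrightarrow>
        x \<in> (\<Union>(n, t)\<in>?P. riemann_set l n t)"
      unfolding UN_iff Bex_def split_paired_Ex mem_Collect_eq case_prod_conv by blast
  qed
  also have "\<dots> \<in> sets circle"
    using riemann_set_sets[OF assms] by (intro sets.countable_UN') auto
  finally show ?thesis .
qed

text \<open>The map \<open>\<phi>\<close> carries the Riemann sets containing
  \<open>flatten l x\<close> onto the rectangles containing \<open>x\<close>, with equal averages.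
  As \<open>h\<close> enters only through integrals, equality holds at every point of the
  torus.\<close>

lemma rectangle_maximal_eq:
  assumes l: "l > 0" and f: "f \<in> borel_measurable circle"
    and h: "AE x in torus. h x = flatten l x" and x: "x \<in> space torus"
  shows "rectangle_maximal (quotient_set l D) (\<lambda>y. f (h y)) x = riemann_maximal l D f (flatten l x)"
proof -
  let ?I = "{(n, t). n \<in> D \<and> n dvd l \<and> t < l div n \<and> flatten l x \<in> riemann_set l n t}"
  let ?J = "{(m, j). m \<in> quotient_set l D \<and> (\<forall>k. j k < side_count m k) \<and> x \<in> rectangle m j}"
  define \<phi> where "\<phi> = (\<lambda>(n, t). (l div n, reversed_residue (l div n) t))"
  have avg: "average circle f (riemann_set l n t) =
      average torus (\<lambda>y. f (h y)) (rectangle (l div n) (reversed_residue (l div n) t))"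
    if n: "n dvd l" "t < l div n" for n t
  proof -
    have "flatten l -` riemann_set l n t \<inter> space torus =
        rectangle (l div n) (reversed_residue (l div n) t)"
      using flatten_mem_riemann_set[OF l n] unfolding rectangle_def by blast
    then show ?thesis
      using average_eq[OF flatten_measure_preserving[OF l] f h riemann_set_sets[OF l n]] by simp
  qed
  have "?J = \<phi> ` ?I"
  proof (intro equalityI subsetI)
    fix p assume "p \<in> ?J"
    then obtain m j where p: "p = (m, j)" and m: "m > 0" "m dvd l" "l div m \<in> D"
      and j: "x \<in> rectangle m j"
      unfolding quotient_set_def by blast
    have div: "l div (l div m) = m" using m(2) l by (metis div_div_eq_right dvd_refl div_self mult_1 gr_implies_not0)
    have "l div m dvd l" using m(2) by (metis dvd_div_mult_self dvd_triv_left)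
    have "j = reversed_residue m (cell l x)"
      using j unfolding rectangle_iff_cell[OF l m(2) x] .
    \<comment> \<open>The cell number is reduced modulo \<open>m\<close> to give an admissible
      \<open>t < m\<close>; the label stays the same.\<close>
    then have j': "j = reversed_residue m (cell l x mod m)"
      using reversed_residue_eq_iff[OF m(1), of "cell l x" "cell l x mod m"] by simp
    have "flatten l x \<in> riemann_set l (l div m) (cell l x mod m)"
      using flatten_mem_riemann_set[OF l \<open>l div m dvd l\<close> _ x, of "cell l x mod m"] j j' m(1) div by simp
    then have "(l div m, cell l x mod m) \<in> ?I"
      using m \<open>l div m dvd l\<close> div by simp
    moreover have "p = \<phi> (l div m, cell l x mod m)" unfolding \<phi>_def p div using div j' by simp
    ultimately show "p \<in> \<phi> ` ?I" by blast
  next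
    fix p assume "p \<in> \<phi> ` ?I"
    then obtain n t where n: "n \<in> D" "n dvd l" "t < l div n" "flatten l x \<in> riemann_set l n t"
      and p: "p = (l div n, reversed_residue (l div n) t)"
      unfolding \<phi>_def by auto
    have "l div (l div n) = n" using n(2) l by (metis div_div_eq_right dvd_refl div_self mult_1 gr_implies_not0)
    moreover have "l div n dvd l" using n(2) by (metis dvd_div_mult_self dvd_triv_left)
    ultimately show "p \<in> ?J"
      unfolding p quotient_set_def
      using n flatten_mem_riemann_set[OF l n(2,3) x] reversed_residue_less by auto
  qed
  then have "rectangle_maximal (quotient_set l D) (\<lambda>y. f (h y)) x =
      (SUP p\<in>?I. case \<phi> p of (m, j) \<Rightarrow> average torus (\<lambda>y. f (h y)) (rectangle m j))"
    unfolding rectangle_maximal_def by (simp only: image_image)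
  also have "\<dots> = riemann_maximal l D f (flatten l x)"
    unfolding riemann_maximal_def
  proof (rule SUP_cong[OF refl])
    fix p assume "p \<in> ?I"
    then show "(case \<phi> p of (m, j) \<Rightarrow> average torus (\<lambda>y. f (h y)) (rectangle m j)) =
        (case p of (n, t) \<Rightarrow> average circle f (riemann_set l n t))"
      unfolding \<phi>_def using avg by auto
  qed
  finally show ?thesis .
qed

theorem theorem4:
  fixes l :: nat
  assumes "l > 0"
  shows "\<exists>\<tau> :: real \<Rightarrow> nat \<Rightarrow> real.
    bij_betw \<tau> (space circle) (space torus) \<and>
    measure_preserving circle torus \<tau> \<and>
    (\<forall>D \<subseteq> {0<..}. \<forall>f :: real \<Rightarrow> real. integrable circle f \<longrightarrow>
      (\<forall>c > 0 :: real.
        emeasure circle {x \<in> space circle. riemann_maximal l D f x > ennreal c} =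
        emeasure torus {x \<in> space torus.
          rectangle_maximal (quotient_set l D) (\<lambda>y. f (inv_into (space circle) \<tau> y)) x
            > ennreal c}))"
proof -
  note G = flatten_measure_preserving[OF assms]
  have into: "flatten l ` space torus \<subseteq> space circle" using flatten_bounds[OF assms] by blast
  obtain \<tau> where \<tau>: "bij_betw \<tau> (space circle) (space torus)"
    "\<And>x. x \<in> space torus \<Longrightarrow> x 1 \<noteq> 0 \<Longrightarrow> \<tau> (flatten l x) = x"
    using bijection_extending_inverse[OF flatten_inj[OF assms] into] by blast
  interpret complete_measure torus
    unfolding torus_def by (rule completion.complete_measure_axioms)
  have mp: "measure_preserving circle torus \<tau>"
    using \<tau>(2) by (intro measure_preserving_of_ae_inverse[OF G \<tau>(1) null_torus]) blast
  let ?h = "inv_into (space circle) \<tau>"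
  \<comment> \<open>\<open>\<tau>\<close> is injective on the circle and sends
    \<open>flatten l x\<close> to \<open>x\<close> off the slab.\<close>
  have "?h x = flatten l x" if "x \<in> space torus" "x 1 \<noteq> 0" for x
    using \<tau> that into unfolding bij_betw_def by (intro inv_into_f_eq) auto
  then have h: "AE x in torus. ?h x = flatten l x"
    by (intro AE_I'[OF null_torus]) blast
  have "emeasure circle {x \<in> space circle. riemann_maximal l D f x > ennreal c} =
      emeasure torus {x \<in> space torus. rectangle_maximal (quotient_set l D) (\<lambda>y. f (?h y)) x > ennreal c}"
    if f: "integrable circle f" for D f c
  proof -
    let ?S = "{x \<in> space circle. riemann_maximal l D f x > ennreal c}"
    have "emeasure circle ?S = emeasure torus (flatten l -` ?S \<inter> space torus)"
      using emeasure_distr[OF G(1) riemann_maximal_superlevel_sets[OF assms]] unfolding G(2) .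
    \<comment> \<open>An exact equality of sets, even where \<open>?h\<close> and
      \<open>flatten l\<close> differ on the null slab.\<close>
    also have "flatten l -` ?S \<inter> space torus =
        {x \<in> space torus. rectangle_maximal (quotient_set l D) (\<lambda>y. f (?h y)) x > ennreal c}"
      using into rectangle_maximal_eq[OF assms borel_measurable_integrable[OF f] h] by auto
    finally show ?thesis .
  qed
  then show ?thesis using \<tau>(1) mp by blast
qed

end
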